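(* Let $G$ be a group, let $g \in G$, and suppose that $r(P)(g) \neq 0$ for some finitely generated projective right $\mathbb{Z}[G]$-module $P$. Then there exists a positive integer $m = m(g)$ such that for all positive integers $s$, the elements $g$ and $g^{s^{m}}$ are conjugate in $G$.
   Context: For a ring $A$, let $[A,A] \subseteq A$ be the additive subgroup generated by all $ab-ba$ with $a,b\in A$. The Hattori-Stallings rank $r(P) \in A/[A,A]$ of a finitely generated projective right $A$-module $P$ is the image of $\operatorname{id}_P$ under the trace homomorphism $\operatorname{Hom}_A(P,P) \xleftarrow{\ \sim\ } P\otimes_A \operatorname{Hom}_A(P,A) \xrightarrow{\ \operatorname{ev}\ } A/[A,A]$. If $A=\mathbb{Z}[G]$ is the integral group ring of a discrete group $G$, then $A/[A,A]$ is canonically the free abelian group on the set $C(G)$ of conjugacy classes of elements of $G$, and one writes uniquely $r(P) = \sum_{[g]\in C(G)} r(P)(g)[g]$ with $r(P)(g)\in\mathbb{Z}$; here $[g]$ is the conjugacy class of $g$. *)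

theory Defs
  imports "HOL-Algebra.Algebra"
begin

section \<open>Right modules over a not necessarily commutative ring\<close>

text \<open>The library's modules are left modules over commutative rings. As there, the fields for
  multiplication and unit inherited from the ring record carry no meaning.\<close>

record ('a, 'b) rmodule = "'b ring" +
  rsmult :: "['b, 'a] \<Rightarrow> 'b" (infixl "\<bullet>\<index>" 70)

locale right_module = R?: ring A + M?: abelian_group M
  for A :: "('a, 'c) ring_scheme" (structure) and M :: "('a, 'b) rmodule" (structure) +
  assumes rsmult_closed:
      "\<lbrakk>x \<in> carrier M; a \<in> carrier A\<rbrakk> \<Longrightarrow> x \<bullet>\<^bsub>M\<^esub> a \<in> carrier M"
    and rsmult_l_distr:
      "\<lbrakk>x \<in> carrier M; y \<in> carrier M; a \<in> carrier A\<rbrakk>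
        \<Longrightarrow> (x \<oplus>\<^bsub>M\<^esub> y) \<bullet>\<^bsub>M\<^esub> a = x \<bullet>\<^bsub>M\<^esub> a \<oplus>\<^bsub>M\<^esub> y \<bullet>\<^bsub>M\<^esub> a"
    and rsmult_r_distr:
      "\<lbrakk>x \<in> carrier M; a \<in> carrier A; b \<in> carrier A\<rbrakk>
        \<Longrightarrow> x \<bullet>\<^bsub>M\<^esub> (a \<oplus>\<^bsub>A\<^esub> b) = x \<bullet>\<^bsub>M\<^esub> a \<oplus>\<^bsub>M\<^esub> x \<bullet>\<^bsub>M\<^esub> b"
    and rsmult_assoc:
      "\<lbrakk>x \<in> carrier M; a \<in> carrier A; b \<in> carrier A\<rbrakk>
        \<Longrightarrow> x \<bullet>\<^bsub>M\<^esub> (a \<otimes>\<^bsub>A\<^esub> b) = (x \<bullet>\<^bsub>M\<^esub> a) \<bullet>\<^bsub>M\<^esub> b"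
    and rsmult_one:
      "x \<in> carrier M \<Longrightarrow> x \<bullet>\<^bsub>M\<^esub> \<one>\<^bsub>A\<^esub> = x"

definition regular_rmodule :: "('a, 'c) ring_scheme \<Rightarrow> ('a, 'a) rmodule" where
  "regular_rmodule A =
     \<lparr>carrier = carrier A, monoid.mult = monoid.mult A, one = one A, ring.zero = ring.zero A, ring.add = ring.add A,
      rsmult = monoid.mult A\<rparr>"

text \<open>Homomorphisms are extensional on the carrier, so that equality of homomorphisms is
  equality of functions.\<close>

definition rmod_hom ::
    "('a, 'c) ring_scheme \<Rightarrow> ('a, 'm) rmodule \<Rightarrow> ('a, 'n) rmodule \<Rightarrow> ('m \<Rightarrow> 'n) set" where
  "rmod_hom A M N =
     {f \<in> carrier M \<rightarrow>\<^sub>E carrier N.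
        (\<forall>x\<in>carrier M. \<forall>y\<in>carrier M. f (x \<oplus>\<^bsub>M\<^esub> y) = f x \<oplus>\<^bsub>N\<^esub> f y) \<and>
        (\<forall>x\<in>carrier M. \<forall>a\<in>carrier A. f (x \<bullet>\<^bsub>M\<^esub> a) = f x \<bullet>\<^bsub>N\<^esub> a)}"

definition hom_group ::
    "('a, 'c) ring_scheme \<Rightarrow> ('a, 'm) rmodule \<Rightarrow> ('a, 'n) rmodule \<Rightarrow> ('m \<Rightarrow> 'n) monoid" where
  "hom_group A M N =
     \<lparr>carrier = rmod_hom A M N,
      monoid.mult = (\<lambda>f g. \<lambda>x\<in>carrier M. f x \<oplus>\<^bsub>N\<^esub> g x),
      one = (\<lambda>x\<in>carrier M. \<zero>\<^bsub>N\<^esub>)\<rparr>"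

definition fin_gen_rmodule :: "('a, 'c) ring_scheme \<Rightarrow> ('a, 'p) rmodule \<Rightarrow> bool" where
  "fin_gen_rmodule A P \<longleftrightarrow> right_module A P \<and>
     (\<exists>S. finite S \<and> S \<subseteq> carrier P \<and>
       (\<forall>x\<in>carrier P. \<exists>c\<in>S \<rightarrow> carrier A. x = (\<Oplus>\<^bsub>P\<^esub>s\<in>S. s \<bullet>\<^bsub>P\<^esub> c s)))"

text \<open>The lifting property. A definition can only quantify over test modules of fixed types; the
  ones used here accommodate the canonical surjection from the free module on the carrier of
  \<open>P\<close>, and so give the lifting property against test modules of all types: see
  \<open>projective_rmodule_lift\<close> below.\<close>

definition projective_rmodule :: "('a, 'c) ring_scheme \<Rightarrow> ('a, 'p) rmodule \<Rightarrow> bool" where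
  "projective_rmodule A P \<longleftrightarrow> right_module A P \<and>
     (\<forall>(N :: ('a, 'p \<Rightarrow> 'a) rmodule) (Q :: ('a, 'p) rmodule) \<pi> f.
        right_module A N \<and> right_module A Q \<and>
        \<pi> \<in> rmod_hom A N Q \<and> \<pi> ` carrier N = carrier Q \<and> f \<in> rmod_hom A P Q \<longrightarrow>
        (\<exists>h\<in>rmod_hom A P N. \<forall>x\<in>carrier P. \<pi> (h x) = f x))"

context right_module
begin

lemma rsmult_zero_left: "a \<in> carrier A \<Longrightarrow> \<zero>\<^bsub>M\<^esub> \<bullet>\<^bsub>M\<^esub> a = \<zero>\<^bsub>M\<^esub>"
  by (metis M.add.l_cancel_one M.l_zero M.zero_closed rsmult_closed rsmult_l_distr)

lemma rsmult_zero_right: "x \<in> carrier M \<Longrightarrow> x \<bullet>\<^bsub>M\<^esub> \<zero>\<^bsub>A\<^esub> = \<zero>\<^bsub>M\<^esub>"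
  by (metis M.add.l_cancel_one R.l_zero R.zero_closed rsmult_closed rsmult_r_distr)

lemma finsum_rsmult:
  assumes "finite T" "u \<in> T \<rightarrow> carrier M" "a \<in> carrier A"
  shows "(\<Oplus>\<^bsub>M\<^esub>t\<in>T. u t) \<bullet>\<^bsub>M\<^esub> a = (\<Oplus>\<^bsub>M\<^esub>t\<in>T. u t \<bullet>\<^bsub>M\<^esub> a)"
  using assms
proof (induction T rule: finite_induct)
  case empty
  then show ?case by (simp add: rsmult_zero_left)
next
  case (insert t T)
  then have "u \<in> T \<rightarrow> carrier M" "u t \<in> carrier M" by auto
  moreover have "(\<lambda>t. u t \<bullet>\<^bsub>M\<^esub> a) \<in> T \<rightarrow> carrier M"
    using insert.prems by (auto intro: rsmult_closed)
  ultimately show ?case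
    using insert by (simp add: rsmult_l_distr rsmult_closed)
qed

end

definition free_rmodule :: "('a, 'c) ring_scheme \<Rightarrow> 's set \<Rightarrow> ('a, 's \<Rightarrow> 'a) rmodule" where
  "free_rmodule A S =
     \<lparr>carrier = {\<phi>. finite {x. \<phi> x \<noteq> \<zero>\<^bsub>A\<^esub>} \<and> {x. \<phi> x \<noteq> \<zero>\<^bsub>A\<^esub>} \<subseteq> S \<and> range \<phi> \<subseteq> carrier A},
      monoid.mult = undefined, one = undefined, ring.zero = (\<lambda>x. \<zero>\<^bsub>A\<^esub>),
      ring.add = (\<lambda>\<phi> \<psi> x. \<phi> x \<oplus>\<^bsub>A\<^esub> \<psi> x), rsmult = (\<lambda>\<phi> a x. \<phi> x \<otimes>\<^bsub>A\<^esub> a)\<rparr>"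

lemma right_module_free_rmodule:
  assumes "ring A"
  shows "right_module A (free_rmodule A S)"
proof -
  interpret ring A by fact
  let ?F = "free_rmodule A S"
  have supp: "finite {x. h x \<noteq> \<zero>\<^bsub>A\<^esub>} \<and> {x. h x \<noteq> \<zero>\<^bsub>A\<^esub>} \<subseteq> S"
    if "\<phi> \<in> carrier ?F" "\<psi> \<in> carrier ?F"
      "\<And>x. \<phi> x = \<zero>\<^bsub>A\<^esub> \<Longrightarrow> \<psi> x = \<zero>\<^bsub>A\<^esub> \<Longrightarrow> h x = \<zero>\<^bsub>A\<^esub>" for h \<phi> \<psi>
  proof -
    have "{x. h x \<noteq> \<zero>\<^bsub>A\<^esub>} \<subseteq> {x. \<phi> x \<noteq> \<zero>\<^bsub>A\<^esub>} \<union> {x. \<psi> x \<noteq> \<zero>\<^bsub>A\<^esub>}" using that by auto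
    moreover have "finite ({x. \<phi> x \<noteq> \<zero>\<^bsub>A\<^esub>} \<union> {x. \<psi> x \<noteq> \<zero>\<^bsub>A\<^esub>})"
      "{x. \<phi> x \<noteq> \<zero>\<^bsub>A\<^esub>} \<union> {x. \<psi> x \<noteq> \<zero>\<^bsub>A\<^esub>} \<subseteq> S"
      using that by (auto simp: free_rmodule_def)
    ultimately show ?thesis by (meson finite_subset order_trans)
  qed
  have closed: "\<phi> x \<in> carrier A" if "\<phi> \<in> carrier ?F" for \<phi> x
    using that by (auto simp: free_rmodule_def)
  have mem: "h \<in> carrier ?F"
    if "\<phi> \<in> carrier ?F" "\<psi> \<in> carrier ?F"
      "\<And>x. \<phi> x = \<zero>\<^bsub>A\<^esub> \<Longrightarrow> \<psi> x = \<zero>\<^bsub>A\<^esub> \<Longrightarrow> h x = \<zero>\<^bsub>A\<^esub>" "\<And>x. h x \<in> carrier A" for h \<phi> \<psi>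
    using supp[OF that(1-3)] that(4) by (auto simp: free_rmodule_def)
  have add: "\<phi> \<oplus>\<^bsub>?F\<^esub> \<psi> = (\<lambda>x. \<phi> x \<oplus>\<^bsub>A\<^esub> \<psi> x)" for \<phi> \<psi> by (simp add: free_rmodule_def)
  have sm: "\<phi> \<bullet>\<^bsub>?F\<^esub> a = (\<lambda>x. \<phi> x \<otimes>\<^bsub>A\<^esub> a)" for \<phi> a by (simp add: free_rmodule_def)
  have ze: "\<zero>\<^bsub>?F\<^esub> = (\<lambda>x. \<zero>\<^bsub>A\<^esub>)" by (simp add: free_rmodule_def)
  have ze_mem: "\<zero>\<^bsub>?F\<^esub> \<in> carrier ?F" by (auto simp: free_rmodule_def)
  have "abelian_group ?F"
  proof (rule abelian_groupI)
    fix \<phi> \<psi> assume \<phi>: "\<phi> \<in> carrier ?F" and \<psi>: "\<psi> \<in> carrier ?F"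
    note cl = closed[OF \<phi>] closed[OF \<psi>]
    show "\<phi> \<oplus>\<^bsub>?F\<^esub> \<psi> \<in> carrier ?F"
      by (rule mem[OF \<phi> \<psi>]) (simp_all add: add cl)
    show "\<phi> \<oplus>\<^bsub>?F\<^esub> \<psi> = \<psi> \<oplus>\<^bsub>?F\<^esub> \<phi>"
      unfolding add by (rule ext) (simp add: cl a_comm)
    fix \<chi> assume \<chi>: "\<chi> \<in> carrier ?F"
    show "(\<phi> \<oplus>\<^bsub>?F\<^esub> \<psi>) \<oplus>\<^bsub>?F\<^esub> \<chi> = \<phi> \<oplus>\<^bsub>?F\<^esub> (\<psi> \<oplus>\<^bsub>?F\<^esub> \<chi>)"
      unfolding add by (rule ext) (simp add: cl closed[OF \<chi>] a_assoc)
  next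
    fix \<phi> assume \<phi>: "\<phi> \<in> carrier ?F"
    note cl = closed[OF \<phi>]
    show "\<zero>\<^bsub>?F\<^esub> \<oplus>\<^bsub>?F\<^esub> \<phi> = \<phi>"
      unfolding add ze by (rule ext) (simp add: cl)
    have "(\<lambda>x. \<ominus>\<^bsub>A\<^esub> \<phi> x) \<in> carrier ?F"
      by (rule mem[OF \<phi> \<phi>]) (simp_all add: cl)
    moreover have "(\<lambda>x. \<ominus>\<^bsub>A\<^esub> \<phi> x) \<oplus>\<^bsub>?F\<^esub> \<phi> = \<zero>\<^bsub>?F\<^esub>"
      unfolding add ze by (rule ext) (simp add: cl l_neg)
    ultimately show "\<exists>\<psi>\<in>carrier ?F. \<psi> \<oplus>\<^bsub>?F\<^esub> \<phi> = \<zero>\<^bsub>?F\<^esub>" by blast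
  qed (rule ze_mem)
  then show ?thesis
  proof (intro right_module.intro right_module_axioms.intro ring_axioms)
    fix \<phi> a assume \<phi>: "\<phi> \<in> carrier ?F" and a: "a \<in> carrier A"
    note cl = closed[OF \<phi>]
    show "\<phi> \<bullet>\<^bsub>?F\<^esub> a \<in> carrier ?F"
      by (rule mem[OF \<phi> \<phi>]) (simp_all add: sm cl a)
    fix \<psi> assume \<psi>: "\<psi> \<in> carrier ?F"
    show "(\<phi> \<oplus>\<^bsub>?F\<^esub> \<psi>) \<bullet>\<^bsub>?F\<^esub> a = \<phi> \<bullet>\<^bsub>?F\<^esub> a \<oplus>\<^bsub>?F\<^esub> \<psi> \<bullet>\<^bsub>?F\<^esub> a"
      unfolding add sm by (rule ext) (simp add: cl closed[OF \<psi>] a l_distr)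
  next
    fix \<phi> a b assume \<phi>: "\<phi> \<in> carrier ?F" and a: "a \<in> carrier A" and b: "b \<in> carrier A"
    note cl = closed[OF \<phi>]
    show "\<phi> \<bullet>\<^bsub>?F\<^esub> (a \<oplus>\<^bsub>A\<^esub> b) = \<phi> \<bullet>\<^bsub>?F\<^esub> a \<oplus>\<^bsub>?F\<^esub> \<phi> \<bullet>\<^bsub>?F\<^esub> b"
      unfolding add sm by (rule ext) (simp add: cl a b r_distr)
    show "\<phi> \<bullet>\<^bsub>?F\<^esub> (a \<otimes>\<^bsub>A\<^esub> b) = (\<phi> \<bullet>\<^bsub>?F\<^esub> a) \<bullet>\<^bsub>?F\<^esub> b"
      unfolding sm by (rule ext) (simp add: cl a b m_assoc)
  next
    fix \<phi> assume \<phi>: "\<phi> \<in> carrier ?F"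
    show "\<phi> \<bullet>\<^bsub>?F\<^esub> \<one>\<^bsub>A\<^esub> = \<phi>"
      unfolding sm by (rule ext) (simp add: closed[OF \<phi>])
  qed
qed

text \<open>The homomorphism from a free module sending the basis vector at \<open>x\<close> to \<open>n x\<close>.\<close>

definition free_rmodule_map ::
    "('a, 'c) ring_scheme \<Rightarrow> 's set \<Rightarrow> ('a, 'm) rmodule \<Rightarrow> ('s \<Rightarrow> 'm) \<Rightarrow> ('s \<Rightarrow> 'a) \<Rightarrow> 'm" where
  "free_rmodule_map A S M n =
     (\<lambda>\<phi>\<in>carrier (free_rmodule A S). \<Oplus>\<^bsub>M\<^esub>x\<in>{x. \<phi> x \<noteq> \<zero>\<^bsub>A\<^esub>}. n x \<bullet>\<^bsub>M\<^esub> \<phi> x)"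

context right_module
begin

lemma free_rmodule_map_superset:
  assumes "n \<in> S \<rightarrow> carrier M" "\<phi> \<in> carrier (free_rmodule A S)"
    and "finite T" "{x. \<phi> x \<noteq> \<zero>\<^bsub>A\<^esub>} \<subseteq> T" "T \<subseteq> S"
  shows "free_rmodule_map A S M n \<phi> = (\<Oplus>\<^bsub>M\<^esub>x\<in>T. n x \<bullet>\<^bsub>M\<^esub> \<phi> x)"
proof -
  have "range \<phi> \<subseteq> carrier A" using assms(2) by (auto simp: free_rmodule_def)
  then have cl: "n x \<bullet>\<^bsub>M\<^esub> \<phi> x \<in> carrier M" if "x \<in> S" for x
    using that assms(1) by (auto intro!: rsmult_closed)
  have "(\<Oplus>\<^bsub>M\<^esub>x\<in>{x. \<phi> x \<noteq> \<zero>\<^bsub>A\<^esub>}. n x \<bullet>\<^bsub>M\<^esub> \<phi> x) = (\<Oplus>\<^bsub>M\<^esub>x\<in>T. n x \<bullet>\<^bsub>M\<^esub> \<phi> x)"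
    using assms cl
    by (intro M.add.finprod_mono_neutral_cong_left) (auto intro!: rsmult_zero_right)
  then show ?thesis using assms(2) by (simp add: free_rmodule_map_def)
qed

lemma free_rmodule_map_hom:
  assumes n: "n \<in> S \<rightarrow> carrier M"
  shows "free_rmodule_map A S M n \<in> rmod_hom A (free_rmodule A S) M"
proof -
  let ?F = "free_rmodule A S" and ?h = "free_rmodule_map A S M n"
  interpret F: right_module A ?F by (rule right_module_free_rmodule) (rule R.ring_axioms)
  have fin: "finite {x. \<phi> x \<noteq> \<zero>\<^bsub>A\<^esub>}" "{x. \<phi> x \<noteq> \<zero>\<^bsub>A\<^esub>} \<subseteq> S" "\<phi> x \<in> carrier A"
    if "\<phi> \<in> carrier ?F" for \<phi> x
    using that by (auto simp: free_rmodule_def)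
  have cl: "(\<lambda>x. n x \<bullet>\<^bsub>M\<^esub> \<phi> x) \<in> T \<rightarrow> carrier M" if "\<phi> \<in> carrier ?F" "T \<subseteq> S" for \<phi> T
    using that n fin(3) by (auto intro!: rsmult_closed)
  have closed: "?h \<phi> \<in> carrier M" if "\<phi> \<in> carrier ?F" for \<phi>
    using that cl[OF that fin(2)[OF that]]
    by (simp add: free_rmodule_map_superset[OF n that fin(1)[OF that] subset_refl fin(2)[OF that]])
  have add: "?h (\<phi> \<oplus>\<^bsub>?F\<^esub> \<psi>) = ?h \<phi> \<oplus>\<^bsub>M\<^esub> ?h \<psi>" if \<phi>: "\<phi> \<in> carrier ?F" and \<psi>: "\<psi> \<in> carrier ?F" for \<phi> \<psi>
  proof -
    let ?T = "{x. \<phi> x \<noteq> \<zero>\<^bsub>A\<^esub>} \<union> {x. \<psi> x \<noteq> \<zero>\<^bsub>A\<^esub>}"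
    have T: "finite ?T" "?T \<subseteq> S" using fin \<phi> \<psi> by auto
    have sum: "\<phi> \<oplus>\<^bsub>?F\<^esub> \<psi> \<in> carrier ?F" using \<phi> \<psi> by simp
    have sum_eq: "\<phi> \<oplus>\<^bsub>?F\<^esub> \<psi> = (\<lambda>x. \<phi> x \<oplus>\<^bsub>A\<^esub> \<psi> x)" by (simp add: free_rmodule_def)
    have supp: "{x. (\<phi> \<oplus>\<^bsub>?F\<^esub> \<psi>) x \<noteq> \<zero>\<^bsub>A\<^esub>} \<subseteq> ?T" by (auto simp: sum_eq)
    have "?h (\<phi> \<oplus>\<^bsub>?F\<^esub> \<psi>) = (\<Oplus>\<^bsub>M\<^esub>x\<in>?T. n x \<bullet>\<^bsub>M\<^esub> (\<phi> \<oplus>\<^bsub>?F\<^esub> \<psi>) x)"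
      by (rule free_rmodule_map_superset[OF n sum T(1) supp T(2)])
    also have "\<dots> = (\<Oplus>\<^bsub>M\<^esub>x\<in>?T. n x \<bullet>\<^bsub>M\<^esub> \<phi> x \<oplus>\<^bsub>M\<^esub> n x \<bullet>\<^bsub>M\<^esub> \<psi> x)"
      using T(2) n fin(3)[OF \<phi>] fin(3)[OF \<psi>]
      by (intro M.add.finprod_cong')
        (auto simp: sum_eq intro!: rsmult_r_distr rsmult_closed M.add.m_closed)
    also have "\<dots> = (\<Oplus>\<^bsub>M\<^esub>x\<in>?T. n x \<bullet>\<^bsub>M\<^esub> \<phi> x) \<oplus>\<^bsub>M\<^esub> (\<Oplus>\<^bsub>M\<^esub>x\<in>?T. n x \<bullet>\<^bsub>M\<^esub> \<psi> x)"
      by (rule M.add.finprod_multf[OF cl[OF \<phi> T(2)] cl[OF \<psi> T(2)]])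
    also have "\<dots> = ?h \<phi> \<oplus>\<^bsub>M\<^esub> ?h \<psi>"
      by (simp add: free_rmodule_map_superset[OF n \<phi> T(1) _ T(2)]
          free_rmodule_map_superset[OF n \<psi> T(1) _ T(2)])
    finally show ?thesis .
  qed
  have smult: "?h (\<phi> \<bullet>\<^bsub>?F\<^esub> a) = ?h \<phi> \<bullet>\<^bsub>M\<^esub> a" if \<phi>: "\<phi> \<in> carrier ?F" and a: "a \<in> carrier A" for \<phi> a
  proof -
    let ?T = "{x. \<phi> x \<noteq> \<zero>\<^bsub>A\<^esub>}"
    have eq: "\<phi> \<bullet>\<^bsub>?F\<^esub> a = (\<lambda>x. \<phi> x \<otimes>\<^bsub>A\<^esub> a)" by (simp add: free_rmodule_def)
    have supp: "{x. (\<phi> \<bullet>\<^bsub>?F\<^esub> a) x \<noteq> \<zero>\<^bsub>A\<^esub>} \<subseteq> ?T" using a by (auto simp: eq)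
    have "?h (\<phi> \<bullet>\<^bsub>?F\<^esub> a) = (\<Oplus>\<^bsub>M\<^esub>x\<in>?T. n x \<bullet>\<^bsub>M\<^esub> (\<phi> \<bullet>\<^bsub>?F\<^esub> a) x)"
      by (rule free_rmodule_map_superset[OF n F.rsmult_closed[OF \<phi> a] fin(1)[OF \<phi>] supp fin(2)[OF \<phi>]])
    also have "\<dots> = (\<Oplus>\<^bsub>M\<^esub>x\<in>?T. (n x \<bullet>\<^bsub>M\<^esub> \<phi> x) \<bullet>\<^bsub>M\<^esub> a)"
      using fin(2)[OF \<phi>] n fin(3)[OF \<phi>] a
      by (intro M.add.finprod_cong') (auto simp: eq intro!: rsmult_assoc rsmult_closed)
    also have "\<dots> = (\<Oplus>\<^bsub>M\<^esub>x\<in>?T. n x \<bullet>\<^bsub>M\<^esub> \<phi> x) \<bullet>\<^bsub>M\<^esub> a"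
      by (rule finsum_rsmult[symmetric, OF fin(1)[OF \<phi>] cl[OF \<phi> fin(2)[OF \<phi>]] a])
    also have "\<dots> = ?h \<phi> \<bullet>\<^bsub>M\<^esub> a"
      by (simp add: free_rmodule_map_superset[OF n \<phi> fin(1)[OF \<phi>] subset_refl fin(2)[OF \<phi>]])
    finally show ?thesis .
  qed
  have "?h \<in> extensional (carrier ?F)" by (simp add: free_rmodule_map_def)
  then show ?thesis using closed add smult by (auto simp: rmod_hom_def PiE_def)
qed

lemma free_rmodule_map_surj:
  "free_rmodule_map A (carrier M) M (\<lambda>x. x) ` carrier (free_rmodule A (carrier M)) = carrier M"
    (is "?h ` carrier ?F = _")
proof
  show "?h ` carrier ?F \<subseteq> carrier M"
    using free_rmodule_map_hom[of "\<lambda>x. x" "carrier M"] by (auto simp: rmod_hom_def)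
  show "carrier M \<subseteq> ?h ` carrier ?F"
  proof
    fix p assume p: "p \<in> carrier M"
    let ?e = "\<lambda>x. if x = p then \<one>\<^bsub>A\<^esub> else \<zero>\<^bsub>A\<^esub>"
    have sub: "{x. ?e x \<noteq> \<zero>\<^bsub>A\<^esub>} \<subseteq> {p}" by auto
    then have e: "?e \<in> carrier ?F"
      using p finite_subset[OF sub] by (auto simp: free_rmodule_def)
    have "?h ?e = (\<Oplus>\<^bsub>M\<^esub>x\<in>{p}. x \<bullet>\<^bsub>M\<^esub> ?e x)"
      by (rule free_rmodule_map_superset) (use e p in auto)
    also have "\<dots> = p" using p by (simp add: rsmult_one)
    finally show "p \<in> ?h ` carrier ?F" using e by (metis imageI)
  qed
qed

end

lemma rmod_hom_free_rmodule_map: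
  assumes M: "right_module A M" and Q: "right_module A Q" and g: "g \<in> rmod_hom A M Q"
    and n: "n \<in> S \<rightarrow> carrier M" and \<phi>: "\<phi> \<in> carrier (free_rmodule A S)"
  shows "g (free_rmodule_map A S M n \<phi>) = free_rmodule_map A S Q (\<lambda>x. g (n x)) \<phi>"
proof -
  interpret M: right_module A M by fact
  interpret Q: right_module A Q by fact
  have gc: "g x \<in> carrier Q" if "x \<in> carrier M" for x using g that by (auto simp: rmod_hom_def)
  have ga: "g (x \<oplus>\<^bsub>M\<^esub> y) = g x \<oplus>\<^bsub>Q\<^esub> g y" if "x \<in> carrier M" "y \<in> carrier M" for x y
    using g that by (auto simp: rmod_hom_def)
  have gs: "g (x \<bullet>\<^bsub>M\<^esub> a) = g x \<bullet>\<^bsub>Q\<^esub> a" if "x \<in> carrier M" "a \<in> carrier A" for x a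
    using g that by (auto simp: rmod_hom_def)
  have g0: "g \<zero>\<^bsub>M\<^esub> = \<zero>\<^bsub>Q\<^esub>"
  proof -
    have "g \<zero>\<^bsub>M\<^esub> \<oplus>\<^bsub>Q\<^esub> g \<zero>\<^bsub>M\<^esub> = g \<zero>\<^bsub>M\<^esub>" using ga[of "\<zero>\<^bsub>M\<^esub>" "\<zero>\<^bsub>M\<^esub>"] by simp
    then show ?thesis using gc[of "\<zero>\<^bsub>M\<^esub>"] by simp
  qed
  let ?T = "{x. \<phi> x \<noteq> \<zero>\<^bsub>A\<^esub>}"
  have T: "finite ?T" "?T \<subseteq> S" "\<And>x. \<phi> x \<in> carrier A" using \<phi> by (auto simp: free_rmodule_def)
  have "g (\<Oplus>\<^bsub>M\<^esub>x\<in>U. n x \<bullet>\<^bsub>M\<^esub> \<phi> x) = (\<Oplus>\<^bsub>Q\<^esub>x\<in>U. g (n x) \<bullet>\<^bsub>Q\<^esub> \<phi> x)"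
    if "finite U" "U \<subseteq> S" for U
    using that
  proof (induction U rule: finite_induct)
    case empty
    then show ?case by (simp add: g0)
  next
    case (insert u U)
    have "n u \<in> carrier M" "(\<lambda>x. n x \<bullet>\<^bsub>M\<^esub> \<phi> x) \<in> U \<rightarrow> carrier M"
      "(\<lambda>x. g (n x) \<bullet>\<^bsub>Q\<^esub> \<phi> x) \<in> U \<rightarrow> carrier Q"
      using insert.prems n T(3) gc by (auto intro!: M.rsmult_closed Q.rsmult_closed)
    then show ?case
      using insert T(3) by (simp add: ga gs gc M.rsmult_closed Q.rsmult_closed)
  qed
  from this[OF T(1,2)] show ?thesis using \<phi> by (simp add: free_rmodule_map_def)
qed

lemma projective_rmodule_lift:
  fixes N :: "('a, 'n) rmodule" and Q :: "('a, 'q) rmodule"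
  assumes P: "projective_rmodule A P" and N: "right_module A N" and Q: "right_module A Q"
    and \<pi>: "\<pi> \<in> rmod_hom A N Q" "\<pi> ` carrier N = carrier Q" and f: "f \<in> rmod_hom A P Q"
  shows "\<exists>h\<in>rmod_hom A P N. \<forall>x\<in>carrier P. \<pi> (h x) = f x"
proof -
  have rP: "right_module A P" using P by (simp add: projective_rmodule_def)
  interpret P: right_module A P by fact
  interpret N: right_module A N by fact
  interpret Q: right_module A Q by fact
  let ?S = "carrier P"
  let ?F = "free_rmodule A ?S" and ?\<epsilon> = "free_rmodule_map A ?S P (\<lambda>x. x)"
  have F: "right_module A ?F" by (rule right_module_free_rmodule) (rule P.R.ring_axioms)
  have \<epsilon>: "?\<epsilon> \<in> rmod_hom A ?F P" by (rule P.free_rmodule_map_hom) simp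
  have id: "(\<lambda>x\<in>carrier P. x) \<in> rmod_hom A P P"
    using P.rsmult_closed by (auto simp: rmod_hom_def)
  obtain s where s: "s \<in> rmod_hom A P ?F" "\<And>x. x \<in> carrier P \<Longrightarrow> ?\<epsilon> (s x) = x"
    using conjunct2[OF P[unfolded projective_rmodule_def], rule_format, OF conjI[OF F conjI[OF rP
      conjI[OF \<epsilon> conjI[OF P.free_rmodule_map_surj id]]]]] by auto
  have "\<exists>n. \<forall>x\<in>carrier P. n x \<in> carrier N \<and> \<pi> (n x) = f x"
  proof (rule bchoice, rule ballI)
    fix x assume "x \<in> carrier P"
    then have "f x \<in> \<pi> ` carrier N" using f \<pi> by (auto simp: rmod_hom_def)
    then show "\<exists>y. y \<in> carrier N \<and> \<pi> y = f x" by auto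
  qed
  then obtain n where n: "\<And>x. x \<in> carrier P \<Longrightarrow> n x \<in> carrier N"
    "\<And>x. x \<in> carrier P \<Longrightarrow> \<pi> (n x) = f x" by blast
  let ?\<kappa> = "free_rmodule_map A ?S N n"
  have \<kappa>: "?\<kappa> \<in> rmod_hom A ?F N" by (rule N.free_rmodule_map_hom) (use n in auto)
  let ?h = "\<lambda>x\<in>carrier P. ?\<kappa> (s x)"
  have sF: "s x \<in> carrier ?F" if "x \<in> carrier P" for x using s(1) that by (auto simp: rmod_hom_def)
  have "?h \<in> rmod_hom A P N"
    using s(1) \<kappa> P.rsmult_closed by (auto simp: rmod_hom_def PiE_iff)
  moreover have "\<pi> (?h x) = f x" if x: "x \<in> carrier P" for x
  proof -
    have "\<pi> (?\<kappa> (s x)) = free_rmodule_map A ?S Q (\<lambda>x. \<pi> (n x)) (s x)"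
      by (rule rmod_hom_free_rmodule_map[OF N Q \<pi>(1) _ sF[OF x]]) (use n in auto)
    also have "\<dots> = free_rmodule_map A ?S Q f (s x)"
    proof -
      have sub: "{y. s x y \<noteq> \<zero>\<^bsub>A\<^esub>} \<subseteq> carrier P" and cl: "s x y \<in> carrier A" for y
        using sF[OF x] by (auto simp: free_rmodule_def)
      have "(\<Oplus>\<^bsub>Q\<^esub>y\<in>{y. s x y \<noteq> \<zero>\<^bsub>A\<^esub>}. \<pi> (n y) \<bullet>\<^bsub>Q\<^esub> s x y)
          = (\<Oplus>\<^bsub>Q\<^esub>y\<in>{y. s x y \<noteq> \<zero>\<^bsub>A\<^esub>}. f y \<bullet>\<^bsub>Q\<^esub> s x y)"
      proof (rule Q.M.add.finprod_cong')
        show "(\<lambda>y. f y \<bullet>\<^bsub>Q\<^esub> s x y) \<in> {y. s x y \<noteq> \<zero>\<^bsub>A\<^esub>} \<rightarrow> carrier Q"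
        proof
          fix y assume "y \<in> {y. s x y \<noteq> \<zero>\<^bsub>A\<^esub>}"
          then have "f y \<in> carrier Q" using sub f by (auto simp: rmod_hom_def)
          then show "f y \<bullet>\<^bsub>Q\<^esub> s x y \<in> carrier Q" by (rule Q.rsmult_closed[OF _ cl])
        qed
        show "\<pi> (n y) \<bullet>\<^bsub>Q\<^esub> s x y = f y \<bullet>\<^bsub>Q\<^esub> s x y" if "y \<in> {y. s x y \<noteq> \<zero>\<^bsub>A\<^esub>}" for y
          using n(2)[of y] sub that by (simp add: subset_iff)
      qed simp
      then show ?thesis using sF[OF x] by (simp add: free_rmodule_map_def)
    qed
    also have "\<dots> = f (?\<epsilon> (s x))"
      by (rule rmod_hom_free_rmodule_map[symmetric, OF rP Q f _ sF[OF x]]) simp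
    also have "\<dots> = f x" by (simp add: s(2)[OF x])
    finally show ?thesis using x by simp
  qed
  ultimately show ?thesis by blast
qed

section \<open>The Hattori-Stallings rank\<close>

definition commutator_subgroup :: "('a, 'c) ring_scheme \<Rightarrow> 'a set" where
  "commutator_subgroup A =
     generate (add_monoid A)
       {a \<otimes>\<^bsub>A\<^esub> b \<ominus>\<^bsub>A\<^esub> b \<otimes>\<^bsub>A\<^esub> a | a b. a \<in> carrier A \<and> b \<in> carrier A}"

text \<open>The group \<open>A/[A,A]\<close>, written multiplicatively.\<close>

definition commutator_quotient :: "('a, 'c) ring_scheme \<Rightarrow> 'a set monoid" where
  "commutator_quotient A = add_monoid A Mod commutator_subgroup A"

text \<open>The homomorphism from a free abelian group to the abelian group \<open>H\<close> extending a map
  \<open>\<phi>\<close> on the basis.\<close>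

definition free_ext :: "('h, 'd) monoid_scheme \<Rightarrow> ('s \<Rightarrow> 'h) \<Rightarrow> ('s \<Rightarrow>\<^sub>0 int) \<Rightarrow> 'h" where
  "free_ext H \<phi> c =
     finprod H (\<lambda>x. \<phi> x [^]\<^bsub>H\<^esub> Poly_Mapping.lookup c x) (Poly_Mapping.keys c)"

text \<open>The dual \<open>Hom_A(P, A)\<close>, a left \<open>A\<close>-module through \<open>(a f)(x) = a (f x)\<close>.\<close>

abbreviation dual :: "('a, 'c) ring_scheme \<Rightarrow> ('a, 'p) rmodule \<Rightarrow> ('p \<Rightarrow> 'a) set" where
  "dual A P \<equiv> rmod_hom A P (regular_rmodule A)"

definition dual_lsmult ::
    "('a, 'c) ring_scheme \<Rightarrow> ('a, 'p) rmodule \<Rightarrow> 'a \<Rightarrow> ('p \<Rightarrow> 'a) \<Rightarrow> 'p \<Rightarrow> 'a" where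
  "dual_lsmult A P a f = (\<lambda>x\<in>carrier P. a \<otimes>\<^bsub>A\<^esub> f x)"

text \<open>The abelian group \<open>P \<otimes>\<^sub>A Hom_A(P, A)\<close>: the free abelian group on the pairs \<open>(p, f)\<close>
  modulo biadditivity and balancedness.\<close>

definition tensor_dual_relations ::
    "('a, 'c) ring_scheme \<Rightarrow> ('a, 'p) rmodule \<Rightarrow> (('p \<times> ('p \<Rightarrow> 'a)) \<Rightarrow>\<^sub>0 int) set" where
  "tensor_dual_relations A P =
     {frag_of (p \<oplus>\<^bsub>P\<^esub> q, f) - frag_of (p, f) - frag_of (q, f) | p q f.
        p \<in> carrier P \<and> q \<in> carrier P \<and> f \<in> dual A P} \<union>
     {frag_of (p, f \<otimes>\<^bsub>hom_group A P (regular_rmodule A)\<^esub> g) - frag_of (p, f) - frag_of (p, g) | p f g.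
        p \<in> carrier P \<and> f \<in> dual A P \<and> g \<in> dual A P} \<union>
     {frag_of (p \<bullet>\<^bsub>P\<^esub> a, f) - frag_of (p, dual_lsmult A P a f) | p a f.
        p \<in> carrier P \<and> a \<in> carrier A \<and> f \<in> dual A P}"

definition tensor_dual ::
    "('a, 'c) ring_scheme \<Rightarrow> ('a, 'p) rmodule \<Rightarrow> (('p \<times> ('p \<Rightarrow> 'a)) \<Rightarrow>\<^sub>0 int) set monoid" where
  "tensor_dual A P =
     free_Abelian_group (carrier P \<times> dual A P) Mod
       generate (free_Abelian_group (carrier P \<times> dual A P)) (tensor_dual_relations A P)"

text \<open>The canonical map \<open>P \<otimes>\<^sub>A Hom_A(P, A) \<rightarrow> Hom_A(P, P)\<close>, \<open>p \<otimes> f \<mapsto> (x \<mapsto> p (f x))\<close>, and the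
  evaluation \<open>P \<otimes>\<^sub>A Hom_A(P, A) \<rightarrow> A/[A,A]\<close>, \<open>p \<otimes> f \<mapsto> f p\<close>. Both are constant on the cosets that
  make up the tensor product, so the image of a coset is a singleton.\<close>

definition tensor_dual_to_End ::
    "('a, 'c) ring_scheme \<Rightarrow> ('a, 'p) rmodule \<Rightarrow> (('p \<times> ('p \<Rightarrow> 'a)) \<Rightarrow>\<^sub>0 int) set \<Rightarrow> 'p \<Rightarrow> 'p" where
  "tensor_dual_to_End A P C =
     the_elem (free_ext (hom_group A P P) (\<lambda>(p, f). \<lambda>x\<in>carrier P. p \<bullet>\<^bsub>P\<^esub> f x) ` C)"

definition tensor_dual_eval ::
    "('a, 'c) ring_scheme \<Rightarrow> ('a, 'p) rmodule \<Rightarrow> (('p \<times> ('p \<Rightarrow> 'a)) \<Rightarrow>\<^sub>0 int) set \<Rightarrow> 'a set" where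
  "tensor_dual_eval A P C =
     the_elem (free_ext (commutator_quotient A)
       (\<lambda>(p, f). commutator_subgroup A #>\<^bsub>add_monoid A\<^esub> f p) ` C)"

definition hattori_stallings_trace ::
    "('a, 'c) ring_scheme \<Rightarrow> ('a, 'p) rmodule \<Rightarrow> ('p \<Rightarrow> 'p) \<Rightarrow> 'a set" where
  "hattori_stallings_trace A P u =
     tensor_dual_eval A P (inv_into (carrier (tensor_dual A P)) (tensor_dual_to_End A P) u)"

definition hattori_stallings_rank ::
    "('a, 'c) ring_scheme \<Rightarrow> ('a, 'p) rmodule \<Rightarrow> 'a set" where
  "hattori_stallings_rank A P = hattori_stallings_trace A P (\<lambda>x\<in>carrier P. x)"

section \<open>Integral group rings\<close>

text \<open>The free abelian group on \<open>G\<close>, with the biadditive extension of the product of \<open>G\<close>.\<close>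

definition int_group_ring :: "('g, 'x) monoid_scheme \<Rightarrow> ('g \<Rightarrow>\<^sub>0 int) ring" where
  "int_group_ring G =
     \<lparr>carrier = carrier (free_Abelian_group (carrier G)),
      monoid.mult = (\<lambda>a b. frag_extend (\<lambda>x. frag_extend (\<lambda>y. frag_of (x \<otimes>\<^bsub>G\<^esub> y)) b) a),
      one = frag_of \<one>\<^bsub>G\<^esub>, ring.zero = 0, ring.add = (+)\<rparr>"

definition conj_class :: "('g, 'x) monoid_scheme \<Rightarrow> 'g \<Rightarrow> 'g set" where
  "conj_class G g = {x \<otimes>\<^bsub>G\<^esub> g \<otimes>\<^bsub>G\<^esub> inv\<^bsub>G\<^esub> x | x. x \<in> carrier G}"

text \<open>The canonical isomorphism from \<open>A/[A,A]\<close>, for \<open>A = \<int>[G]\<close>, to the free abelian group on the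
  set of conjugacy classes, induced by \<open>g \<mapsto> [g]\<close>.\<close>

definition to_conj_classes :: "('g, 'x) monoid_scheme \<Rightarrow> ('g \<Rightarrow>\<^sub>0 int) set \<Rightarrow> ('g set \<Rightarrow>\<^sub>0 int)" where
  "to_conj_classes G C = the_elem (frag_extend (\<lambda>x. frag_of (conj_class G x)) ` C)"

definition hs_coeff :: "('g, 'x) monoid_scheme \<Rightarrow> ('g \<Rightarrow>\<^sub>0 int, 'p) rmodule \<Rightarrow> 'g \<Rightarrow> int" where
  "hs_coeff G P g =
     Poly_Mapping.lookup (to_conj_classes G (hattori_stallings_rank (int_group_ring G) P))
       (conj_class G g)"

end

theory Submission
  imports Defs "HOL-Number_Theory.Residues"
begin

text \<open>A preimage of the identity under \<open>P \<otimes> Hom(P, A) \<rightarrow> Hom(P, P)\<close> yields an idempotent matrix \<open>E\<close>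
  over \<open>\<int>[G]\<close> whose trace is \<open>r(P)\<close>. Write \<open>F\<^sub>s\<close> for the additive map \<open>[x] \<mapsto> [x ^ s]\<close> on the
  free abelian group on the conjugacy classes. For a prime \<open>p\<close>, expand the trace of \<open>E ^ (p ^ k)\<close>
  as a sum over cyclic words of length \<open>p ^ k\<close>: words that are not \<open>p\<close>-th powers have rotation
  orbits of size \<open>p ^ k\<close>, and the remaining ones contribute \<open>F\<^sub>p\<close> of the trace of \<open>E ^ (p ^ (k - 1))\<close>
  up to multiples of \<open>p ^ k\<close>. As \<open>E\<close> is idempotent, \<open>r(P)\<close> is congruent to \<open>F\<^sub>p r(P)\<close> modulo \<open>p ^ k\<close>
  for all \<open>k\<close>, so the two are equal, and hence \<open>F\<^sub>s r(P) = r(P)\<close> for all \<open>s > 0\<close>. Therefore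
  \<open>[x] \<mapsto> [x ^ s]\<close> maps the finite support of \<open>r(P)\<close> onto itself, and \<open>m\<close> can be taken to be the
  factorial of the size of the support.\<close>

section \<open>Words and rotations\<close>

lemma funpow_fixed_mult:
  assumes "(\<sigma> ^^ m) x = x"
  shows "(\<sigma> ^^ (n * m)) x = x"
  using assms by (induction n) (simp_all add: funpow_add)

text \<open>Bezout over the naturals: some multiple of \<open>m\<close> is a multiple of
  \<open>n\<close> plus the gcd, and the iterates of both multiples fix \<open>x\<close>.\<close>

lemma funpow_fixed_gcd:
  assumes "(\<sigma> ^^ m) x = x" and "(\<sigma> ^^ n) x = x" and "m > 0"
  shows "(\<sigma> ^^ gcd m n) x = x"
proof -
  obtain a b where ab: "m * a = n * b + gcd m n"
    using bezout_nat[of m n] assms(3) by auto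
  have "(\<sigma> ^^ (m * a)) x = x" "(\<sigma> ^^ (n * b)) x = x"
    using funpow_fixed_mult[OF assms(1), of a] funpow_fixed_mult[OF assms(2), of b]
    by (simp_all add: mult.commute)
  then show ?thesis by (metis ab add.commute comp_apply funpow_add)
qed

text \<open>Each orbit has a length dividing \<open>p ^ Suc k\<close> but not \<open>p ^ k\<close>,
  hence exactly \<open>p ^ Suc k\<close>, and \<open>f\<close> is constant on it. The induction
  removes one orbit at a time.\<close>

lemma prime_power_dvd_sum_invariant:
  fixes f :: "'a \<Rightarrow> int" and p :: nat
  assumes "Factorial_Ring.prime p" and "finite B"
    and "\<And>x. x \<in> B \<Longrightarrow> \<sigma> x \<in> B"
    and "\<And>x. x \<in> B \<Longrightarrow> (\<sigma> ^^ (p ^ Suc k)) x = x"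
    and "\<And>x. x \<in> B \<Longrightarrow> (\<sigma> ^^ (p ^ k)) x \<noteq> x"
    and "\<And>x. x \<in> B \<Longrightarrow> f (\<sigma> x) = f x"
  shows "int p ^ Suc k dvd sum f B"
  using assms(2-6)
proof (induction B rule: finite_psubset_induct)
  case (psubset B)
  note closed = psubset.prems(1) and per = psubset.prems(2) and free = psubset.prems(3)
    and inv = psubset.prems(4)
  show ?case
  proof (cases "B = {}")
    case False
    then obtain x where x: "x \<in> B" by auto
    let ?q = "p ^ Suc k"
    have q: "?q > 0" using assms(1) prime_gt_0_nat by auto
    let ?O = "(\<lambda>i. (\<sigma> ^^ i) x) ` {..<?q}"
    have mem: "(\<sigma> ^^ i) x \<in> B" for i by (induction i) (use x closed in auto)
    have fi: "f ((\<sigma> ^^ i) x) = f x" for i by (induction i) (use mem inv in auto)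
    have inj: "inj_on (\<lambda>i. (\<sigma> ^^ i) x) {..<?q}"
    proof (rule linorder_inj_onI)
      fix i j assume ij: "i < j" "i \<in> {..<?q}" "j \<in> {..<?q}"
      show "(\<sigma> ^^ i) x \<noteq> (\<sigma> ^^ j) x"
      proof
        assume eq: "(\<sigma> ^^ i) x = (\<sigma> ^^ j) x"
        let ?d = "j - i" and ?y = "(\<sigma> ^^ i) x"
        have d: "(\<sigma> ^^ ?d) ?y = ?y"
          using eq ij by (metis comp_apply funpow_add le_add_diff_inverse2 less_imp_le)
        have y: "?y \<in> B" by (rule mem)
        have fg: "(\<sigma> ^^ gcd ?d ?q) ?y = ?y"
          by (rule funpow_fixed_gcd[OF d per[OF y]]) (use ij in simp)
        \<comment> \<open>A coincidence among the first \<open>?q\<close> iterates would give a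
          period \<open>p ^ e\<close> with \<open>e \<le> k\<close>, hence the excluded period
          \<open>p ^ k\<close>.\<close>
        obtain e where e: "e \<le> Suc k" "gcd ?d ?q = p ^ e"
          using divides_primepow_nat[OF assms(1), of "gcd ?d ?q" "Suc k"] by auto
        have "gcd ?d ?q \<le> ?d" using ij by (intro gcd_le1_nat) simp
        also have "?d < ?q" using ij by auto
        finally have "e \<noteq> Suc k" using e by auto
        then have "p ^ k = p ^ (k - e) * p ^ e" using e by (simp flip: power_add)
        then have "(\<sigma> ^^ (p ^ k)) ?y = ?y"
          using funpow_fixed_mult[OF fg, of "p ^ (k - e)"] e by simp
        then show False using free[OF y] by simp
      qed
    qed auto
    have sub: "?O \<subseteq> B" using mem by auto
    have "sum f ?O = (\<Sum>i<?q. f x)" by (subst sum.reindex[OF inj]) (simp add: fi)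
    then have dO: "int p ^ Suc k dvd sum f ?O" by simp
    \<comment> \<open>In contrapositive form, \<sigma> maps the complement of the orbit into itself:
      \<open>?q - 1\<close> further applications of \<sigma> lead from \<open>\<sigma> y\<close>
      back to \<open>y\<close>.\<close>
    have sO: "y \<in> ?O" if y: "y \<in> B" "\<sigma> y \<in> ?O" for y
    proof -
      obtain i where i: "\<sigma> y = (\<sigma> ^^ i) x" using y by auto
      have "y = (\<sigma> ^^ (?q - 1)) (\<sigma> y)"
        using per[OF y(1)] q by (metis Suc_diff_1 comp_apply funpow_Suc_right)
      also have "\<dots> = (\<sigma> ^^ (?q - 1 + i)) x" by (simp add: i funpow_add)
      also have "\<dots> = (\<sigma> ^^ ((?q - 1 + i) mod ?q)) x"
        by (rule funpow_mod_eq[symmetric]) (rule per[OF x])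
      finally show ?thesis using q by (metis (no_types, lifting) imageI lessThan_iff mod_less_divisor)
    qed
    have "B - ?O \<subset> B" using x q by (auto intro!: image_eqI[where x = 0])
    then have dC: "int p ^ Suc k dvd sum f (B - ?O)"
      by (rule psubset.IH) (use closed per free inv sO in blast)+
    have "sum f B = sum f (B - ?O) + sum f ?O"
      using psubset.hyps sub by (simp add: sum.subset_diff)
    then show ?thesis using dO dC by simp
  qed simp
qed

section \<open>Powers of words and rotation-invariant sums over words\<close>

lemma replicate_concat_commute:
  assumes "u @ v = v @ u" and "length v = n * length u" and "u \<noteq> []"
  shows "v = concat (replicate n u)"
  using assms
proof (induction n arbitrary: v)
  case (Suc n)
  \<comment> \<open>Prefixes of equal length in \<open>u @ v = v @ u\<close> agree; what remains of
    \<open>v\<close> after this copy of \<open>u\<close> commutes with \<open>u\<close>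
    again.\<close>
  have "take (length u) v = u"
    using arg_cong[OF Suc.prems(1), of "take (length u)"] Suc.prems(2) by simp
  then obtain v' where v: "v = u @ v'" by (metis append_take_drop_id)
  have "v' = concat (replicate n u)" by (rule Suc.IH) (use Suc.prems v in auto)
  then show ?case using v by simp
qed simp

lemma rotate_fixed_concat_replicate:
  assumes "rotate m w = w" and "length w = n * m" and "m > 0" and "n > 0"
  shows "w = concat (replicate n (take m w))"
proof -
  have le: "m \<le> length w" using assms by (cases n) auto
  \<comment> \<open>The rotation exchanges the prefix of length \<open>m\<close> with the rest, so
    invariance says that the two commute. A full turn is a separate case because
    \<open>rotate_drop_take\<close> reduces \<open>m\<close> modulo the length.\<close>
  have rot: "drop m w @ take m w = w"
    using assms(1) le by (cases "m = length w") (simp_all add: rotate_drop_take)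
  obtain n' where n: "n = Suc n'" using assms(4) by (cases n) auto
  have "drop m w = concat (replicate n' (take m w))"
    by (rule replicate_concat_commute) (use rot assms le n in auto)
  then show ?thesis by (metis append_take_drop_id concat.simps(2) n replicate_Suc)
qed

lemma rotate_concat_replicate:
  "rotate (length u) (concat (replicate n u)) = concat (replicate n u)"
proof (cases n)
  case (Suc m)
  have "concat (replicate m u) @ u = u @ concat (replicate m u)" by (induction m) auto
  then show ?thesis using Suc by (simp add: rotate_append)
qed simp

definition words :: "'a set \<Rightarrow> nat \<Rightarrow> 'a list set" where
  "words W n = {w. set w \<subseteq> W \<and> length w = n}"

lemma finite_words [simp]: "finite W \<Longrightarrow> finite (words W n)"
  unfolding words_def by (rule finite_lists_length_eq)

lemma words_0 [simp]: "words W 0 = {[]}"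
  by (auto simp: words_def)

lemma sum_words_Suc:
  assumes "finite W"
  shows "sum f (words W (Suc n)) = (\<Sum>l\<in>W. \<Sum>w\<in>words W n. f (l # w))"
proof -
  have "words W (Suc n) = (\<lambda>(l, w). l # w) ` (W \<times> words W n)"
    by (force simp: words_def length_Suc_conv)
  moreover have "inj_on (\<lambda>(l, w). l # w) (W \<times> words W n)" by (auto simp: inj_on_def)
  ultimately have "sum f (words W (Suc n)) = (\<Sum>(l, w)\<in>W \<times> words W n. f (l # w))"
    by (simp add: sum.reindex case_prod_unfold)
  then show ?thesis using assms by (simp add: sum.cartesian_product)
qed

text \<open>Words of length \<open>p ^ Suc k\<close> that are not \<open>p\<close>-th powers lie in free orbits under rotation.\<close>

lemma sum_words_prime_power_cong:
  fixes f :: "'a list \<Rightarrow> int" and p :: nat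
  assumes "Factorial_Ring.prime p" and "finite W" and inv: "\<And>w. set w \<subseteq> W \<Longrightarrow> f (rotate1 w) = f w"
  shows "[(\<Sum>w\<in>words W (p ^ Suc k). f w) = (\<Sum>u\<in>words W (p ^ k). f (concat (replicate p u)))]
    (mod int p ^ Suc k)"
proof -
  have p: "p > 0" using assms(1) prime_gt_0_nat by auto
  let ?B = "words W (p ^ Suc k)"
  \<comment> \<open>The words of \<open>?P\<close> are exactly the \<open>p\<close>-th powers of
    their prefixes of length \<open>p ^ k\<close>, and those of \<open>?N\<close> have rotation
    orbits of full size.\<close>
  let ?N = "{w \<in> ?B. rotate (p ^ k) w \<noteq> w}" and ?P = "{w \<in> ?B. rotate (p ^ k) w = w}"
  have rot: "rotate1 ^^ n = rotate n" for n :: nat by (simp add: rotate_def)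
  have "int p ^ Suc k dvd sum f ?N"
  proof (rule prime_power_dvd_sum_invariant[OF assms(1), where \<sigma> = rotate1])
    fix w assume w: "w \<in> ?N"
    have "rotate (p ^ k) (rotate1 w) = rotate1 (rotate (p ^ k) w)"
      by (metis rotate1_rotate_swap)
    then show "rotate1 w \<in> ?N"
      using w by (auto simp: words_def dest!: injD[OF inj_rotate1])
    show "(rotate1 ^^ p ^ Suc k) w = w"
      using w by (simp add: rot words_def)
    show "(rotate1 ^^ p ^ k) w \<noteq> w"
      using w by (simp add: rot)
    show "f (rotate1 w) = f w"
      using w by (intro inv) (simp add: words_def)
  qed (use assms in auto)
  moreover have "sum f ?B = sum f ?P + sum f ?N"
    by (subst sum.union_disjoint[symmetric]) (use assms(2) in \<open>auto intro: sum.cong\<close>)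
  moreover have "sum f ?P = (\<Sum>u\<in>words W (p ^ k). f (concat (replicate p u)))"
  proof (rule sum.reindex_bij_witness[where i = "\<lambda>u. concat (replicate p u)" and j = "take (p ^ k)"])
    fix w assume "w \<in> ?P"
    then have w: "rotate (p ^ k) w = w" "length w = p * p ^ k" "set w \<subseteq> W" by (auto simp: words_def)
    have "w = concat (replicate p (take (p ^ k) w))"
      by (rule rotate_fixed_concat_replicate) (use w p in auto)
    then show "concat (replicate p (take (p ^ k) w)) = w"
      and "f (concat (replicate p (take (p ^ k) w))) = f w" by simp_all
    show "take (p ^ k) w \<in> words W (p ^ k)"
      using w p set_take_subset[of "p ^ k" w] by (auto simp: words_def min_def)
  next
    fix u assume u: "u \<in> words W (p ^ k)"
    obtain q where q: "p = Suc q" using p by (cases p) auto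
    show "take (p ^ k) (concat (replicate p u)) = u"
      using u by (subst (2) q) (simp add: words_def)
    have "rotate (p ^ k) (concat (replicate p u)) = concat (replicate p u)"
      using rotate_concat_replicate[of u p] u by (simp add: words_def)
    then show "concat (replicate p u) \<in> ?P"
      using u by (auto simp: words_def length_concat sum_list_replicate)
  qed
  ultimately show ?thesis by (simp add: cong_iff_dvd_diff)
qed

text \<open>If \<open>a\<close> is prime to \<open>p\<close>, factor out \<open>a ^ (p ^ i)\<close>
  and apply Euler's theorem, the totient of \<open>p ^ Suc i\<close> being
  \<open>p ^ i * (p - 1)\<close>. Otherwise \<open>p\<close> divides \<open>a\<close>, and both
  powers are divisible because their exponents are at least \<open>i + 1\<close>.\<close>

lemma prime_power_dvd_power_diff:
  fixes a :: int and p :: nat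
  assumes "Factorial_Ring.prime p"
  shows "int p ^ Suc i dvd a ^ (p ^ Suc i) - a ^ (p ^ i)"
proof (cases "coprime a (int p)")
  case True
  then have cop: "coprime a (int p ^ Suc i)" by simp
  have m: "int (p ^ Suc i) > 1" using prime_gt_1_nat[OF assms] by (metis of_nat_1 of_nat_less_iff one_less_power zero_less_Suc)
  interpret residues "int (p ^ Suc i)" "residue_ring (int (p ^ Suc i))"
    by unfold_locales (use m in simp_all)
  have "nat (int p ^ Suc i) = p ^ Suc i" by (metis nat_int of_nat_power)
  then have "[a ^ (p ^ i * (p - 1)) = 1] (mod int p ^ Suc i)"
    using euler_theorem[of a, unfolded of_nat_power, OF cop] totient_prime_power_Suc[OF assms, of i]
    by (simp only:)
  then have "int p ^ Suc i dvd a ^ (p ^ i) * (a ^ (p ^ i * (p - 1)) - 1)"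
    by (simp add: cong_iff_dvd_diff)
  moreover have "p ^ Suc i = p ^ i + p ^ i * (p - 1)"
    using prime_gt_0_nat[OF assms] by (cases p) simp_all
  ultimately show ?thesis by (simp add: right_diff_distrib power_add del: power_Suc)
next
  case False
  then have "int p dvd a"
    using assms by (metis coprime_commute prime_imp_coprime prime_nat_int_transfer)
  then have dvd: "int p ^ n dvd a ^ n" for n by (rule dvd_power_same)
  have "i < p ^ i" using prime_gt_1_nat[OF assms] power_gt_expt[of p i] by simp
  moreover have "p ^ i \<le> p ^ Suc i" using prime_gt_0_nat[OF assms] by simp
  ultimately have "int p ^ Suc i dvd a ^ (p ^ i)" "int p ^ Suc i dvd a ^ (p ^ Suc i)"
    using power_le_dvd[OF dvd] by (metis Suc_leI, metis Suc_leI order_trans)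
  then show ?thesis by (rule dvd_diff[rotated])
qed

text \<open>Each difference alone supplies \<open>i + 1\<close> factors \<open>p\<close>; the
  rotations of words of length \<open>p ^ j\<close> supply \<open>j\<close> more. Passing to
  \<open>p\<close>-th powers of shorter words trades a step of \<open>j\<close> for a step of
  \<open>i\<close>, so the induction lets \<open>i\<close> and \<open>h\<close> vary.\<close>

lemma sum_words_power_dvd:
  fixes h \<omega> :: "'a list \<Rightarrow> int" and p :: nat
  assumes p: "Factorial_Ring.prime p" and W: "finite W"
    and \<omega>: "\<And>w. \<omega> (rotate1 w) = \<omega> w" "\<And>w. \<omega> (concat (replicate p w)) = \<omega> w ^ p"
    and h: "\<And>w. set w \<subseteq> W \<Longrightarrow> h (rotate1 w) = h w"
  shows "int p ^ Suc (i + j) dvd (\<Sum>w\<in>words W (p ^ j). h w * (\<omega> w ^ (p ^ Suc i) - \<omega> w ^ (p ^ i)))"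
  using h
proof (induction j arbitrary: i h)
  case 0
  show ?case
    by (intro dvd_sum dvd_mult) (use prime_power_dvd_power_diff[OF p] in simp)
next
  case (Suc j)
  \<comment> \<open>The exact quotient \<open>d\<close> depends on \<open>w\<close> only through
    \<open>\<omega> w\<close>, so the product of \<open>h\<close> and \<open>d\<close> is rotation
    invariant and the orbit congruence applies to it.\<close>
  define d where "d w = (\<omega> w ^ (p ^ Suc i) - \<omega> w ^ (p ^ i)) div int p ^ Suc i" for w
  have d: "\<omega> w ^ (p ^ Suc i) - \<omega> w ^ (p ^ i) = int p ^ Suc i * d w" for w
    unfolding d_def using prime_power_dvd_power_diff[OF p, of i "\<omega> w"] by (simp del: power_Suc)
  let ?r = "\<lambda>w. concat (replicate p w)"
  have rr: "?r (rotate1 w) = rotate1 (?r w)" for w :: "'a list"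
  proof (cases w)
    case (Cons a v)
    have "a # concat (replicate n (v @ [a])) = concat (replicate n (a # v)) @ [a]" for n
      by (induction n) auto
    moreover obtain q where "p = Suc q" using prime_gt_0_nat[OF p] by (cases p) auto
    ultimately show ?thesis using Cons by simp
  qed simp
  have "[(\<Sum>w\<in>words W (p ^ Suc j). h w * d w) = (\<Sum>w\<in>words W (p ^ j). h (?r w) * d (?r w))]
      (mod int p ^ Suc j)"
    by (rule sum_words_prime_power_cong[OF p W]) (simp add: Suc.prems \<omega> d_def)
  then have "int p ^ Suc i * int p ^ Suc j dvd int p ^ Suc i *
      ((\<Sum>w\<in>words W (p ^ Suc j). h w * d w) - (\<Sum>w\<in>words W (p ^ j). h (?r w) * d (?r w)))"
    by (simp add: cong_iff_dvd_diff del: power_Suc)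
  then have "int p ^ Suc (i + Suc j) dvd
      (\<Sum>w\<in>words W (p ^ Suc j). h w * (\<omega> w ^ (p ^ Suc i) - \<omega> w ^ (p ^ i)))
      - (\<Sum>w\<in>words W (p ^ j). h (?r w) * (\<omega> (?r w) ^ (p ^ Suc i) - \<omega> (?r w) ^ (p ^ i)))"
    unfolding d by (simp add: power_add sum_distrib_left right_diff_distrib mult.left_commute mult.assoc)
  moreover have "int p ^ Suc (i + Suc j) dvd
      (\<Sum>w\<in>words W (p ^ j). h (?r w) * (\<omega> (?r w) ^ (p ^ Suc i) - \<omega> (?r w) ^ (p ^ i)))"
  proof -
    \<comment> \<open>On a \<open>p\<close>-th power, \<omega> is raised to the power
      \<open>p\<close>; this moves both exponents up by one and leads to the induction hypothesis at
      \<open>Suc i\<close>.\<close>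
    have "\<omega> (?r w) ^ (p ^ Suc i) - \<omega> (?r w) ^ (p ^ i) = \<omega> w ^ (p ^ Suc (Suc i)) - \<omega> w ^ (p ^ Suc i)" for w
      by (simp add: \<omega> flip: power_mult)
    moreover have "h (?r (rotate1 w)) = h (?r w)" if "set w \<subseteq> W" for w
      unfolding rr by (rule Suc.prems) (use that in auto)
    ultimately show ?thesis using Suc.IH[of "\<lambda>w. h (?r w)" "Suc i"] by simp
  qed
  moreover have "c dvd y" if "c dvd y - x" "c dvd x" for c x y :: int
    using dvd_add[OF that] by simp
  ultimately show ?case by blast
qed

section \<open>Traces of powers of a matrix over a group ring\<close>

text \<open>A letter \<open>(u, x)\<close> stands for a step of a path leaving \<open>u\<close> and labelled by the group element
  \<open>x\<close>; it ends where the next letter starts, and the last letter ends at \<open>v\<close>.\<close>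

definition word_prod :: "('g, 'x) monoid_scheme \<Rightarrow> ('i \<times> 'g) list \<Rightarrow> 'g" where
  "word_prod G w = foldr (\<lambda>(u, x) y. x \<otimes>\<^bsub>G\<^esub> y) w \<one>\<^bsub>G\<^esub>"

fun first_index :: "('i \<times> 'g) list \<Rightarrow> 'i \<Rightarrow> 'i" where
  "first_index [] v = v"
| "first_index ((u, x) # w) v = u"

text \<open>With \<open>a u v x\<close> read as the coefficient of \<open>x\<close> in the entry
  \<open>(u, v)\<close> of a matrix over the group ring, these are the coefficients in the expansion
  of an entry of a power of the matrix.\<close>

fun path_weight :: "('i \<Rightarrow> 'i \<Rightarrow> 'g \<Rightarrow> 'r::comm_semiring_1) \<Rightarrow> ('i \<times> 'g) list \<Rightarrow> 'i \<Rightarrow> 'r" where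
  "path_weight a [] v = 1"
| "path_weight a ((u, x) # w) v = a u (first_index w v) x * path_weight a w v"

text \<open>The path is closed by ending where it starts. The value \<open>undefined\<close> is
  reached only by the empty word, whose weight is 1.\<close>

definition cycle_weight :: "('i \<Rightarrow> 'i \<Rightarrow> 'g \<Rightarrow> 'r::comm_semiring_1) \<Rightarrow> ('i \<times> 'g) list \<Rightarrow> 'r" where
  "cycle_weight a w = path_weight a w (first_index w undefined)"

lemma first_index_append: "first_index (w @ w') v = first_index w (first_index w' v)"
  by (cases w) auto

lemma path_weight_append:
  "path_weight a (w @ w') v = path_weight a w (first_index w' v) * path_weight a w' v"
  by (induction w) (auto simp: first_index_append mult.assoc)

lemma cycle_weight_rotate1: "cycle_weight a (rotate1 w) = cycle_weight a w"
proof (cases w)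
  case (Cons l w')
  then show ?thesis
    by (cases l; cases w') (auto simp: cycle_weight_def path_weight_append first_index_append ac_simps)
qed simp

lemma cycle_weight_concat_replicate:
  "cycle_weight a (concat (replicate n w)) = cycle_weight a w ^ n"
proof (cases "w = []")
  case True
  then show ?thesis by (induction n) (auto simp: cycle_weight_def)
next
  case False
  then obtain u x w' where w: "w = (u, x) # w'" by (metis list.exhaust surj_pair)
  \<comment> \<open>Every copy of \<open>w\<close> starts at \<open>u\<close>, so every copy also
    ends at \<open>u\<close> and contributes the same closed weight.\<close>
  have *: "first_index (concat (replicate n w)) u = u" for n
    by (cases n) (auto simp: w)
  have "path_weight a (concat (replicate n w)) u = path_weight a w u ^ n" for n
    by (induction n) (auto simp: path_weight_append *)
  moreover have "cycle_weight a (concat (replicate n w)) = path_weight a (concat (replicate n w)) u"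
    by (cases n) (auto simp: cycle_weight_def w)
  ultimately show ?thesis by (simp add: cycle_weight_def w)
qed

context group
begin

lemma word_prod_Nil [simp]: "word_prod G [] = \<one>"
  by (simp add: word_prod_def)

lemma word_prod_Cons [simp]: "word_prod G ((u, x) # w) = x \<otimes> word_prod G w"
  by (simp add: word_prod_def)

lemma word_prod_closed: "set w \<subseteq> I \<times> carrier G \<Longrightarrow> word_prod G w \<in> carrier G"
  by (induction w) auto

lemma word_prod_append:
  "set w \<subseteq> I \<times> carrier G \<Longrightarrow> set w' \<subseteq> I \<times> carrier G \<Longrightarrow>
    word_prod G (w @ w') = word_prod G w \<otimes> word_prod G w'"
  by (induction w) (auto simp: m_assoc word_prod_closed)

lemma word_prod_concat_replicate:
  assumes "set w \<subseteq> I \<times> carrier G"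
  shows "word_prod G (concat (replicate n w)) = word_prod G w [^] n"
proof (induction n)
  case (Suc n)
  have "set (concat (replicate n w)) \<subseteq> I \<times> carrier G" using assms by auto
  then have "word_prod G (concat (replicate (Suc n) w)) = word_prod G w \<otimes> word_prod G w [^] n"
    using Suc assms by (simp add: word_prod_append)
  then show ?case using word_prod_closed[OF assms] by (simp add: nat_pow_comm flip: nat_pow_Suc2)
qed simp

text \<open>The power \<open>k + 1\<close> of \<open>x y\<close> is \<open>x\<close> times
  \<open>(y x)^k y\<close>, and that of \<open>y x\<close> is the same product in the other order,
  so one exchange of two factors under \<phi> suffices.\<close>

lemma pow_conj_invariant:
  assumes "\<And>x y. x \<in> carrier G \<Longrightarrow> y \<in> carrier G \<Longrightarrow> \<phi> (x \<otimes> y) = \<phi> (y \<otimes> x)"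
    and "x \<in> carrier G" "y \<in> carrier G"
  shows "\<phi> ((x \<otimes> y) [^] n) = \<phi> ((y \<otimes> x) [^] (n::nat))"
proof (cases n)
  case (Suc m)
  have "(x \<otimes> y) [^] Suc k = x \<otimes> ((y \<otimes> x) [^] k \<otimes> y)" for k :: nat
    by (induction k) (use assms(2,3) in \<open>auto simp: m_assoc\<close>)
  moreover have "(y \<otimes> x) [^] Suc k = ((y \<otimes> x) [^] k \<otimes> y) \<otimes> x" for k :: nat
    using assms(2,3) by (simp add: m_assoc)
  ultimately show ?thesis using assms Suc by simp
qed simp

text \<open>Expanding the entry \<open>(u, v)\<close> of the power \<open>Suc n\<close> of the
  matrix gives the left side, and \<open>idem\<close>, which is idempotence tested on all
  functionals, collapses it one factor at a time. The zeroth power is excluded, being the identity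
  matrix.\<close>

lemma sum_words_path_weight:
  fixes a :: "'i \<Rightarrow> 'i \<Rightarrow> 'a \<Rightarrow> int" and \<phi> :: "'a \<Rightarrow> int"
  assumes I: "finite I" and B: "finite B" "B \<subseteq> carrier G"
    and idem: "\<And>u v \<phi>. u \<in> I \<Longrightarrow> v \<in> I \<Longrightarrow>
      (\<Sum>t\<in>I. \<Sum>y\<in>B. \<Sum>z\<in>B. a u t y * a t v z * \<phi> (y \<otimes> z)) = (\<Sum>x\<in>B. a u v x * (\<phi> x :: int))"
    and uv: "u \<in> I" "v \<in> I"
  shows "(\<Sum>w\<in>words (I \<times> B) (Suc n). if first_index w v = u then path_weight a w v * \<phi> (word_prod G w) else 0)
    = (\<Sum>x\<in>B. a u v x * \<phi> x)"
  using uv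
proof (induction n arbitrary: u \<phi>)
  case 0
  have "(\<Sum>w\<in>words (I \<times> B) (Suc 0). if first_index w v = u then path_weight a w v * \<phi> (word_prod G w) else 0)
      = (\<Sum>u'\<in>I. if u' = u then \<Sum>x\<in>B. a u v x * \<phi> (x \<otimes> \<one>) else 0)"
    unfolding sum_words_Suc[OF finite_cartesian_product[OF I B(1)]] sum.cartesian_product'
    by (auto intro!: sum.cong)
  also have "\<dots> = (\<Sum>x\<in>B. a u v x * \<phi> x)"
    using 0 I B(2) by (auto simp: subset_iff intro!: sum.cong)
  finally show ?case .
next
  case (Suc n)
  let ?W = "words (I \<times> B) (Suc n)"
  have fin: "finite ?W" using I B by simp
  have fi: "first_index w v \<in> I" if "w \<in> ?W" for w
    using that Suc.prems(2) by (cases w) (auto simp: words_def)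
  have "(\<Sum>w\<in>words (I \<times> B) (Suc (Suc n)).
        if first_index w v = u then path_weight a w v * \<phi> (word_prod G w) else 0)
      = (\<Sum>u'\<in>I. if u' = u then \<Sum>y\<in>B. \<Sum>w\<in>?W.
          a u (first_index w v) y * path_weight a w v * \<phi> (y \<otimes> word_prod G w) else 0)"
    unfolding sum_words_Suc[of _ _ "Suc n", OF finite_cartesian_product[OF I B(1)]] sum.cartesian_product'
    by (auto intro!: sum.cong)
  also have "\<dots> = (\<Sum>y\<in>B. \<Sum>w\<in>?W.
      a u (first_index w v) y * path_weight a w v * \<phi> (y \<otimes> word_prod G w))"
    using Suc.prems I by simp
  \<comment> \<open>The index \<open>t\<close> at which the rest of the path starts is made
    explicit, to become the middle index of a matrix product.\<close>
  also have "\<dots> = (\<Sum>y\<in>B. \<Sum>w\<in>?W. \<Sum>t\<in>I. if first_index w v = t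
      then a u t y * path_weight a w v * \<phi> (y \<otimes> word_prod G w) else 0)"
    using I fi by (simp cong: sum.cong)
  also have "\<dots> = (\<Sum>y\<in>B. \<Sum>t\<in>I. \<Sum>w\<in>?W. if first_index w v = t
      then a u t y * path_weight a w v * \<phi> (y \<otimes> word_prod G w) else 0)"
    by (rule sum.cong[OF refl], rule sum.swap)
  also have "\<dots> = (\<Sum>y\<in>B. \<Sum>t\<in>I. a u t y * (\<Sum>w\<in>?W. if first_index w v = t
      then path_weight a w v * \<phi> (y \<otimes> word_prod G w) else 0))"
    by (auto simp: sum_distrib_left mult.assoc intro!: sum.cong)
  \<comment> \<open>The induction hypothesis is applied to the functional sending \<open>z\<close>
    to \<open>\<phi> (y \<otimes> z)\<close>, which is why \<phi> is kept arbitrary.\<close>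
  also have "\<dots> = (\<Sum>y\<in>B. \<Sum>t\<in>I. a u t y * (\<Sum>z\<in>B. a t v z * \<phi> (y \<otimes> z)))"
    by (intro sum.cong refl arg_cong2[where f = "(*)"] Suc.IH[where \<phi> = "\<lambda>z. \<phi> (_ \<otimes> z)"] Suc.prems)
  also have "\<dots> = (\<Sum>t\<in>I. \<Sum>y\<in>B. \<Sum>z\<in>B. a u t y * a t v z * \<phi> (y \<otimes> z))"
    by (subst sum.swap) (simp add: sum_distrib_left mult.assoc)
  finally show ?case using idem[OF Suc.prems] by simp
qed

lemma sum_words_cycle_weight:
  fixes a :: "'i \<Rightarrow> 'i \<Rightarrow> 'a \<Rightarrow> int" and \<phi> :: "'a \<Rightarrow> int"
  assumes I: "finite I" and B: "finite B" "B \<subseteq> carrier G"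
    and idem: "\<And>u v \<phi>. u \<in> I \<Longrightarrow> v \<in> I \<Longrightarrow>
      (\<Sum>t\<in>I. \<Sum>y\<in>B. \<Sum>z\<in>B. a u t y * a t v z * \<phi> (y \<otimes> z)) = (\<Sum>x\<in>B. a u v x * (\<phi> x :: int))"
    and "n > 0"
  shows "(\<Sum>w\<in>words (I \<times> B) n. cycle_weight a w * \<phi> (word_prod G w)) = (\<Sum>u\<in>I. \<Sum>x\<in>B. a u u x * \<phi> x)"
proof -
  let ?W = "words (I \<times> B) n"
  have cw: "first_index w undefined \<in> I"
    "first_index w u = first_index w undefined" if "w \<in> ?W" for w u
    using that \<open>n > 0\<close> by (cases w; auto simp: words_def)+
  have "(\<Sum>w\<in>?W. cycle_weight a w * \<phi> (word_prod G w))
      = (\<Sum>w\<in>?W. \<Sum>u\<in>I. if first_index w undefined = u then path_weight a w u * \<phi> (word_prod G w) else 0)"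
    using I cw(1) by (simp add: cycle_weight_def cong: sum.cong)
  \<comment> \<open>For \<open>n > 0\<close> no word is empty, so the default index has no influence
    and may be replaced by the end \<open>u\<close>.\<close>
  also have "\<dots> = (\<Sum>w\<in>?W. \<Sum>u\<in>I. if first_index w u = u then path_weight a w u * \<phi> (word_prod G w) else 0)"
    by (intro sum.cong refl if_cong) (metis cw(2))
  also have "\<dots> = (\<Sum>u\<in>I. \<Sum>w\<in>?W. if first_index w u = u then path_weight a w u * \<phi> (word_prod G w) else 0)"
    by (rule sum.swap)
  also have "\<dots> = (\<Sum>u\<in>I. \<Sum>x\<in>B. a u u x * \<phi> x)"
    using sum_words_path_weight[OF I B idem, where n = "n - 1"] \<open>n > 0\<close> by (intro sum.cong refl) simp
  finally show ?thesis .
qed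

text \<open>Modulo \<open>p ^ Suc k\<close>, the trace of the power \<open>p ^ Suc k\<close>
  evaluated by \<phi> agrees with the trace of the power \<open>p ^ k\<close> evaluated by \<phi>
  after the \<open>p\<close>-th power map. Idempotence makes both independent of \<open>k\<close>,
  and only 0 is divisible by every power of \<open>p\<close>.\<close>

lemma idempotent_trace_prime_power:
  fixes a :: "'i \<Rightarrow> 'i \<Rightarrow> 'a \<Rightarrow> int" and \<phi> :: "'a \<Rightarrow> int"
  assumes I: "finite I" and B: "finite B" "B \<subseteq> carrier G"
    and idem: "\<And>u v \<phi>. u \<in> I \<Longrightarrow> v \<in> I \<Longrightarrow>
      (\<Sum>t\<in>I. \<Sum>y\<in>B. \<Sum>z\<in>B. a u t y * a t v z * \<phi> (y \<otimes> z)) = (\<Sum>x\<in>B. a u v x * (\<phi> x :: int))"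
    and \<phi>: "\<And>x y. x \<in> carrier G \<Longrightarrow> y \<in> carrier G \<Longrightarrow> \<phi> (x \<otimes> y) = \<phi> (y \<otimes> x)"
    and p: "Factorial_Ring.prime (p::nat)"
  shows "(\<Sum>u\<in>I. \<Sum>x\<in>B. a u u x * \<phi> x) = (\<Sum>u\<in>I. \<Sum>x\<in>B. a u u x * \<phi> (x [^] p))"
    (is "?l = ?r")
proof -
  let ?W = "I \<times> B" and ?c = "cycle_weight a" and ?\<pi> = "word_prod G"
  have W: "finite ?W" using I B by simp
  have wc: "set w \<subseteq> I \<times> carrier G" if "set w \<subseteq> ?W" for w using that B(2) by blast
  \<comment> \<open>A rotation turns the product \<open>x y\<close> of a word into
    \<open>y x\<close>. Allowing every power \<open>n\<close> covers both \<phi> and its composite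
    with the \<open>p\<close>-th power map.\<close>
  have rot: "\<phi> (?\<pi> (rotate1 w) [^] n) = \<phi> (?\<pi> w [^] n)" if "set w \<subseteq> ?W" for w and n :: nat
  proof (cases w)
    case (Cons l w')
    obtain u x where l: "l = (u, x)" by force
    have "set w' \<subseteq> I \<times> carrier G" "set [(u, x)] \<subseteq> I \<times> carrier G"
      using wc[OF that] Cons l by auto
    then show ?thesis
      using Cons l word_prod_closed[of w' I] pow_conj_invariant[of \<phi>, OF \<phi>, of "?\<pi> w'" x n]
      by (simp add: word_prod_append[where I = I])
  qed simp
  have dvd: "int p ^ Suc k dvd ?l - ?r" for k
  proof -
    have "[(\<Sum>w\<in>words ?W (p ^ Suc k). ?c w * \<phi> (?\<pi> w)) = (\<Sum>w\<in>words ?W (p ^ k).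
        ?c (concat (replicate p w)) * \<phi> (?\<pi> (concat (replicate p w))))] (mod int p ^ Suc k)"
    proof (rule sum_words_prime_power_cong[OF p W])
      show "?c (rotate1 w) * \<phi> (?\<pi> (rotate1 w)) = ?c w * \<phi> (?\<pi> w)" if "set w \<subseteq> ?W" for w
        using rot[OF that, of 1] wc[OF that]
        by (simp add: cycle_weight_rotate1 word_prod_closed[where I = I])
    qed
    also have "(\<Sum>w\<in>words ?W (p ^ k). ?c (concat (replicate p w)) * \<phi> (?\<pi> (concat (replicate p w))))
        = (\<Sum>w\<in>words ?W (p ^ k). ?c w ^ p * \<phi> (?\<pi> w [^] p))"
      by (intro sum.cong refl)
        (simp add: cycle_weight_concat_replicate words_def wc word_prod_concat_replicate[where I = I])
    \<comment> \<open>The \<open>p\<close>-th powers of words carry the weight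
      \<open>?c w ^ p\<close>; the case \<open>i = 0\<close> of \<open>sum_words_power_dvd\<close>
      replaces it by \<open>?c w\<close>.\<close>
    also have "[\<dots> = (\<Sum>w\<in>words ?W (p ^ k). ?c w * \<phi> (?\<pi> w [^] p))] (mod int p ^ Suc k)"
    proof -
      have "int p ^ Suc (0 + k) dvd
          (\<Sum>w\<in>words ?W (p ^ k). \<phi> (?\<pi> w [^] p) * (?c w ^ (p ^ Suc 0) - ?c w ^ (p ^ 0)))"
        by (rule sum_words_power_dvd[OF p W])
          (simp_all add: cycle_weight_rotate1 cycle_weight_concat_replicate rot)
      then show ?thesis
        by (simp add: cong_iff_dvd_diff right_diff_distrib sum_subtractf mult.commute)
    qed
    also have "(\<Sum>w\<in>words ?W (p ^ Suc k). ?c w * \<phi> (?\<pi> w)) = ?l"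
      by (rule sum_words_cycle_weight[OF I B idem]) (use prime_gt_0_nat[OF p] in auto)
    also have "(\<Sum>w\<in>words ?W (p ^ k). ?c w * \<phi> (?\<pi> w [^] p)) = ?r"
      by (rule sum_words_cycle_weight[OF I B idem, where \<phi> = "\<lambda>x. \<phi> (x [^] p)"])
        (use prime_gt_0_nat[OF p] in auto)
    finally show ?thesis by (simp add: cong_iff_dvd_diff)
  qed
  show ?thesis
  proof (rule ccontr)
    assume ne: "?l \<noteq> ?r"
    \<comment> \<open>A nonzero difference of absolute value \<open>d\<close> cannot be divisible by
      \<open>p ^ Suc d\<close>, which exceeds \<open>d\<close>.\<close>
    define d where "d = nat \<bar>?l - ?r\<bar>"
    have d: "d > 0" "int d = \<bar>?l - ?r\<bar>" using ne by (auto simp: d_def)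
    have "int (p ^ Suc d) dvd int d" using dvd[of d] d by simp
    then have "p ^ Suc d \<le> d" using d(1) by (intro dvd_imp_le) (simp_all only: of_nat_dvd_iff)
    moreover have "Suc d < p ^ Suc d" using prime_gt_1_nat[OF p] power_gt_expt[of p "Suc d"] by simp
    ultimately show False by simp
  qed
qed

text \<open>Induction along a prime factorisation of \<open>s\<close>: composing \<phi> with a power
  map keeps it invariant under the exchange of two factors, so the prime case can be used
  repeatedly.\<close>

lemma idempotent_trace_power:
  fixes a :: "'i \<Rightarrow> 'i \<Rightarrow> 'a \<Rightarrow> int" and \<phi> :: "'a \<Rightarrow> int"
  assumes I: "finite I" and B: "finite B" "B \<subseteq> carrier G"
    and idem: "\<And>u v \<phi>. u \<in> I \<Longrightarrow> v \<in> I \<Longrightarrow>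
      (\<Sum>t\<in>I. \<Sum>y\<in>B. \<Sum>z\<in>B. a u t y * a t v z * \<phi> (y \<otimes> z)) = (\<Sum>x\<in>B. a u v x * (\<phi> x :: int))"
    and \<phi>: "\<And>x y. x \<in> carrier G \<Longrightarrow> y \<in> carrier G \<Longrightarrow> \<phi> (x \<otimes> y) = \<phi> (y \<otimes> x)"
    and "s > 0"
  shows "(\<Sum>u\<in>I. \<Sum>x\<in>B. a u u x * \<phi> x) = (\<Sum>u\<in>I. \<Sum>x\<in>B. a u u x * \<phi> (x [^] (s::nat)))"
  using \<open>s > 0\<close> \<phi>
proof (induction s arbitrary: \<phi> rule: prime_divisors_induct)
  case zero
  then show ?case by simp
next
  case (unit s)
  have "x \<in> carrier G" if "x \<in> B" for x using that B by blast
  then show ?case using unit by (intro sum.cong refl) simp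
next
  case (factor p s)
  have "s > 0" using factor.prems(1) by simp
  have pw: "(x [^] s) [^] p = x [^] (p * s)" if "x \<in> B" for x
    using that B by (auto simp: nat_pow_pow mult.commute)
  have "(\<Sum>u\<in>I. \<Sum>x\<in>B. a u u x * \<phi> x) = (\<Sum>u\<in>I. \<Sum>x\<in>B. a u u x * \<phi> (x [^] p))"
    by (rule idempotent_trace_prime_power[where \<phi> = \<phi>, OF I B idem factor.prems(2) factor.hyps(1)])
  also have "\<dots> = (\<Sum>u\<in>I. \<Sum>x\<in>B. a u u x * \<phi> ((x [^] s) [^] p))"
    by (rule factor.IH[of "\<lambda>x. \<phi> (x [^] p)", OF \<open>s > 0\<close>])
      (rule pow_conj_invariant[where \<phi> = \<phi>, OF factor.prems(2)])
  finally show ?case using pw by (simp cong: sum.cong)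
qed

end

section \<open>Conjugacy classes of powers\<close>

text \<open>Two of the iterates \<open>0\<close> to \<open>card D\<close> coincide at
  \<open>x\<close>, injectivity cancels the smaller one, and the resulting period divides the
  factorial. The exponent depends on \<open>D\<close> alone, so that one \<open>m\<close> will serve
  all power maps.\<close>

lemma funpow_fact_card_fixed:
  assumes "finite D" and "inj_on F D" and "F ` D \<subseteq> D" and "x \<in> D"
  shows "(F ^^ fact (card D)) x = x"
proof -
  have mem: "(F ^^ i) y \<in> D" if "y \<in> D" for i y by (induction i) (use assms that in auto)
  have inj: "inj_on (F ^^ i) D" for i
  proof (induction i)
    case (Suc i)
    have "inj_on F ((F ^^ i) ` D)" by (rule inj_on_subset[OF assms(2)]) (use mem in blast)
    then show ?case using comp_inj_on[OF Suc] by (simp add: o_def)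
  qed simp
  have "\<exists>i j. i < j \<and> j \<le> card D \<and> (F ^^ i) x = (F ^^ j) x"
  proof (rule ccontr)
    assume "\<not> ?thesis"
    then have "inj_on (\<lambda>i. (F ^^ i) x) {..card D}" by (intro linorder_inj_onI) auto
    then have "card {..card D} \<le> card D"
      by (rule card_inj_on_le) (use mem assms in auto)
    then show False by simp
  qed
  then obtain i j where ij: "i < j" "j \<le> card D" "(F ^^ i) x = (F ^^ j) x" by blast
  have "(F ^^ i) ((F ^^ (j - i)) x) = (F ^^ (i + (j - i))) x" by (simp only: funpow_add o_apply)
  then have "(F ^^ i) ((F ^^ (j - i)) x) = (F ^^ i) x" using ij by simp
  then have "(F ^^ (j - i)) x = x" by (rule inj_onD[OF inj]) (use mem assms in auto)
  moreover have "j - i dvd fact (card D)" using ij by (intro dvd_fact) auto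
  then obtain n where "fact (card D) = n * (j - i)" by (auto simp: dvd_def mult.commute)
  ultimately show ?thesis using funpow_fixed_mult[of "j - i" F x n] by simp
qed

context group
begin

lemma conj_class_self: "x \<in> carrier G \<Longrightarrow> x \<in> conj_class G x"
  unfolding conj_class_def by (auto intro!: exI[of _ "\<one>"])

lemma conj_class_eq:
  assumes "x \<in> carrier G" and "y \<in> conj_class G x"
  shows "conj_class G y = conj_class G x"
proof -
  \<comment> \<open>One inclusion for arbitrary conjugates suffices, because \<open>x\<close> is in
    turn the conjugate of \<open>y\<close> by \<open>inv z\<close>.\<close>
  have sub: "conj_class G (z \<otimes> w \<otimes> inv z) \<subseteq> conj_class G w"
    if "z \<in> carrier G" "w \<in> carrier G" for z w
  proof
    fix v assume "v \<in> conj_class G (z \<otimes> w \<otimes> inv z)"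
    then obtain t where t: "t \<in> carrier G" "v = t \<otimes> (z \<otimes> w \<otimes> inv z) \<otimes> inv t"
      by (auto simp: conj_class_def)
    then have "v = (t \<otimes> z) \<otimes> w \<otimes> inv (t \<otimes> z)" using that by (simp add: m_assoc inv_mult_group)
    then show "v \<in> conj_class G w" using t that by (auto simp: conj_class_def)
  qed
  obtain z where z: "z \<in> carrier G" "y = z \<otimes> x \<otimes> inv z"
    using assms(2) by (auto simp: conj_class_def)
  then have y: "y \<in> carrier G" "inv z \<otimes> y \<otimes> inv (inv z) = x"
    using assms(1) by (simp_all add: m_assoc inv_solve_left')
  show ?thesis using sub[OF z(1) assms(1)] sub[of "inv z" y] y z by auto
qed

lemma conj_class_mult_commute:
  assumes "x \<in> carrier G" "y \<in> carrier G"
  shows "conj_class G (x \<otimes> y) = conj_class G (y \<otimes> x)"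
proof -
  have "x \<otimes> y = x \<otimes> (y \<otimes> x) \<otimes> inv x" using assms by (simp add: m_assoc)
  then have "x \<otimes> y \<in> conj_class G (y \<otimes> x)" using assms by (auto simp: conj_class_def)
  then show ?thesis using assms by (intro conj_class_eq) auto
qed

text \<open>A conjugate \<open>y\<close> is the product of \<open>z\<close> and
  \<open>x \<otimes> inv z\<close>, and the same two factors in the other order give
  \<open>x\<close>, so \<open>pow_conj_invariant\<close> applies to the map
  \<open>conj_class G\<close>.\<close>

lemma conj_class_pow:
  assumes "x \<in> carrier G" "y \<in> conj_class G x"
  shows "conj_class G (y [^] n) = conj_class G (x [^] (n::nat))"
proof -
  obtain z where z: "z \<in> carrier G" "y = z \<otimes> (x \<otimes> inv z)"
    using assms by (auto simp: conj_class_def m_assoc)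
  have "conj_class G ((z \<otimes> (x \<otimes> inv z)) [^] n) = conj_class G (((x \<otimes> inv z) \<otimes> z) [^] n)"
    by (rule pow_conj_invariant[where \<phi> = "conj_class G"]) (use z assms in \<open>simp_all add: conj_class_mult_commute\<close>)
  then show ?thesis using z assms by (simp add: m_assoc)
qed

text \<open>The union avoids choosing a representative; for a conjugacy class all the united sets
  are equal.\<close>

definition pow_class :: "nat \<Rightarrow> 'a set \<Rightarrow> 'a set" where
  "pow_class s C = (\<Union>x\<in>C. conj_class G (x [^] s))"

lemma pow_class_conj_class: "x \<in> carrier G \<Longrightarrow> pow_class s (conj_class G x) = conj_class G (x [^] s)"
  using conj_class_pow conj_class_self unfolding pow_class_def by blast

lemma pow_class_funpow:
  "x \<in> carrier G \<Longrightarrow> (pow_class s ^^ n) (conj_class G x) = conj_class G (x [^] (s ^ n))"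
  by (induction n) (simp_all add: pow_class_conj_class nat_pow_pow mult.commute)

text \<open>By \<open>pow\<close>, the total coefficient of a class is the sum of the total
  coefficients over its fibre under \<open>pow_class s\<close>, so every class in the support is the
  image of one in the support. Finiteness makes the map a permutation of the support.\<close>

lemma conj_class_power_periodic:
  fixes c :: "'a \<Rightarrow> int"
  assumes B: "finite B" "B \<subseteq> carrier G" and g: "g \<in> carrier G"
    and pow: "\<And>C (s::nat). s > 0 \<Longrightarrow>
      (\<Sum>x\<in>B. c x * of_bool (conj_class G x = C)) = (\<Sum>x\<in>B. c x * of_bool (conj_class G (x [^] s) = C))"
    and ne: "(\<Sum>x\<in>B. c x * of_bool (conj_class G x = conj_class G g)) \<noteq> 0"
  shows "\<exists>m::nat. m > 0 \<and> (\<forall>s::nat. s > 0 \<longrightarrow> g [^] (s ^ m) \<in> conj_class G g)"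
proof -
  define r where "r C = (\<Sum>x\<in>B. c x * of_bool (conj_class G x = C))" for C
  define D where "D = {C. r C \<noteq> 0}"
  have DB: "D \<subseteq> conj_class G ` B"
  proof
    fix C assume "C \<in> D"
    then have "\<exists>x\<in>B. c x * of_bool (conj_class G x = C) \<noteq> 0"
      unfolding D_def r_def mem_Collect_eq by (rule contrapos_np) (auto intro: sum.neutral)
    then show "C \<in> conj_class G ` B" by auto
  qed
  then have fD: "finite D" using B(1) finite_surj by blast
  have gD: "conj_class G g \<in> D" using ne by (simp add: D_def r_def)
  have "g [^] (s ^ fact (card D)) \<in> conj_class G g" if s: "s > 0" for s :: nat
  proof -
    have sub: "D \<subseteq> pow_class s ` D"
    proof
      fix C assume C: "C \<in> D"
      have "r C = (\<Sum>x\<in>B. c x * of_bool (conj_class G (x [^] s) = C))"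
        unfolding r_def by (rule pow[OF s])
      also have "\<dots> = (\<Sum>x\<in>B. c x * of_bool (pow_class s (conj_class G x) = C))"
        using B(2) by (intro sum.cong refl) (auto simp: pow_class_conj_class)
      also have "\<dots> = (\<Sum>x\<in>B. \<Sum>C'\<in>conj_class G ` B.
          c x * of_bool (conj_class G x = C') * of_bool (pow_class s C' = C))"
      proof (rule sum.cong[OF refl])
        fix x assume "x \<in> B"
        then show "c x * of_bool (pow_class s (conj_class G x) = C) = (\<Sum>C'\<in>conj_class G ` B.
            c x * of_bool (conj_class G x = C') * of_bool (pow_class s C' = C))"
          using B(1) by (subst sum.remove[of _ "conj_class G x"]) (auto intro!: sum.neutral)
      qed
      also have "\<dots> = (\<Sum>C'\<in>conj_class G ` B. r C' * of_bool (pow_class s C' = C))"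
        unfolding r_def sum_distrib_right by (rule sum.swap)
      finally have "(\<Sum>C'\<in>conj_class G ` B. r C' * of_bool (pow_class s C' = C)) \<noteq> 0"
        using C by (simp add: D_def)
      then have "\<exists>C'\<in>conj_class G ` B. r C' * of_bool (pow_class s C' = C) \<noteq> 0"
        by (rule contrapos_np) (auto intro: sum.neutral)
      then show "C \<in> pow_class s ` D" by (auto simp: D_def)
    qed
    \<comment> \<open>A finite set contained in its own image equals that image by cardinality, and
      the map is then injective on it.\<close>
    have eq: "D = pow_class s ` D"
      by (rule card_seteq) (use fD sub card_image_le in auto)
    then have "inj_on (pow_class s) D" using fD by (metis eq_card_imp_inj_on)
    then have "(pow_class s ^^ fact (card D)) (conj_class G g) = conj_class G g"
      by (rule funpow_fact_card_fixed[OF fD]) (use eq gD in auto)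
    then show ?thesis
      using g conj_class_self[of "g [^] (s ^ fact (card D))"] by (simp add: pow_class_funpow)
  qed
  then show ?thesis by (intro exI[of _ "fact (card D)"]) simp
qed

end

section \<open>The Hattori-Stallings rank\<close>

lemma free_ext_superset:
  assumes "comm_group H" and "\<phi> \<in> S \<rightarrow> carrier H"
    and "finite T" and "Poly_Mapping.keys c \<subseteq> T" and "T \<subseteq> S"
  shows "free_ext H \<phi> c = finprod H (\<lambda>x. \<phi> x [^]\<^bsub>H\<^esub> Poly_Mapping.lookup c x) T"
proof -
  interpret comm_group H by fact
  show ?thesis
    unfolding free_ext_def
    by (rule finprod_mono_neutral_cong_left) (use assms in \<open>auto simp: in_keys_iff Pi_iff\<close>)
qed

lemma free_ext_hom:
  assumes "comm_group H" and "\<phi> \<in> S \<rightarrow> carrier H"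
  shows "free_ext H \<phi> \<in> hom (free_Abelian_group S) H"
proof (rule homI)
  interpret comm_group H by fact
  have cl: "\<phi> x [^]\<^bsub>H\<^esub> (n::int) \<in> carrier H" if "x \<in> S" for x n using assms(2) that by auto
  fix a assume a: "a \<in> carrier (free_Abelian_group S)"
  then show "free_ext H \<phi> a \<in> carrier H"
    unfolding free_ext_def using cl by (intro finprod_closed) auto
  fix b assume b: "b \<in> carrier (free_Abelian_group S)"
  let ?T = "Poly_Mapping.keys a \<union> Poly_Mapping.keys b"
  have T: "finite ?T" "?T \<subseteq> S" using a b by auto
  have "free_ext H \<phi> (a + b) = finprod H (\<lambda>x. \<phi> x [^]\<^bsub>H\<^esub> Poly_Mapping.lookup (a + b) x) ?T"
    by (rule free_ext_superset[OF assms T(1) keys_add T(2)])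
  also have "\<dots> = finprod H (\<lambda>x. \<phi> x [^]\<^bsub>H\<^esub> Poly_Mapping.lookup a x \<otimes>\<^bsub>H\<^esub> \<phi> x [^]\<^bsub>H\<^esub> Poly_Mapping.lookup b x) ?T"
    using T assms(2) by (intro finprod_cong') (auto simp: lookup_add int_pow_mult Pi_iff subset_iff)
  also have "\<dots> = free_ext H \<phi> a \<otimes>\<^bsub>H\<^esub> free_ext H \<phi> b"
    using T cl by (subst finprod_multf) (auto simp: free_ext_superset[OF assms T(1) _ T(2)])
  finally show "free_ext H \<phi> (a \<otimes>\<^bsub>free_Abelian_group S\<^esub> b) = free_ext H \<phi> a \<otimes>\<^bsub>H\<^esub> free_ext H \<phi> b"
    by simp
qed

lemma free_ext_frag_of:
  assumes "comm_group H" and "\<phi> x \<in> carrier H"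
  shows "free_ext H \<phi> (frag_of x) = \<phi> x"
proof -
  interpret comm_group H by fact
  show ?thesis using assms(2) by (simp add: free_ext_def)
qed

lemma hom_free_Abelian_group_eqI:
  assumes H: "group H" and h: "h \<in> hom (free_Abelian_group S) H" and k: "k \<in> hom (free_Abelian_group S) H"
    and eq: "\<And>x. x \<in> S \<Longrightarrow> h (frag_of x) = k (frag_of x)" and c: "Poly_Mapping.keys c \<subseteq> S"
  shows "h c = k c"
proof -
  interpret h: group_hom "free_Abelian_group S" H h
    by (intro group_hom.intro group_hom_axioms.intro) (simp_all add: H h)
  interpret k: group_hom "free_Abelian_group S" H k
    by (intro group_hom.intro group_hom_axioms.intro) (simp_all add: H k)
  have diff: "f (x - y) = f x \<otimes>\<^bsub>H\<^esub> inv\<^bsub>H\<^esub> f y"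
    if "group_hom (free_Abelian_group S) H f" "Poly_Mapping.keys x \<subseteq> S" "Poly_Mapping.keys y \<subseteq> S" for f x y
  proof -
    interpret f: group_hom "free_Abelian_group S" H f by fact
    show ?thesis using f.hom_mult[of x "- y"] f.hom_inv[of y] that by simp
  qed
  show ?thesis
  proof (rule free_Abelian_group_induct[OF c])
    show "h 0 = k 0" using h.hom_one k.hom_one by simp
    show "h (x - y) = k (x - y)" if "Poly_Mapping.keys x \<subseteq> S" "Poly_Mapping.keys y \<subseteq> S"
      "h x = k x" "h y = k y" for x y
      using that by (simp add: diff h.group_hom_axioms k.group_hom_axioms)
  qed (rule eq)
qed

text \<open>Both sides are homomorphisms in \<open>c\<close> that agree on the basis.\<close>

lemma free_ext_hom_eq:
  assumes H: "comm_group H" and K: "comm_group K" and \<phi>: "\<phi> \<in> S \<rightarrow> carrier H"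
    and h: "h \<in> hom H K" and c: "Poly_Mapping.keys c \<subseteq> S"
  shows "h (free_ext H \<phi> c) = free_ext K (\<lambda>x. h (\<phi> x)) c"
proof -
  have \<psi>: "(\<lambda>x. h (\<phi> x)) \<in> S \<rightarrow> carrier K" using \<phi> h by (auto simp: hom_def)
  have "(h \<circ> free_ext H \<phi>) c = free_ext K (\<lambda>x. h (\<phi> x)) c"
    by (rule hom_free_Abelian_group_eqI[OF _ hom_compose[OF free_ext_hom[OF H \<phi>] h] free_ext_hom[OF K \<psi>] _ c])
      (use K \<phi> \<psi> in \<open>auto simp: comm_group_def free_ext_frag_of[OF H] free_ext_frag_of[OF K] Pi_iff\<close>)
  then show ?thesis by simp
qed

lemma free_ext_sum_frag_of:
  assumes H: "comm_group H" and \<phi>: "\<phi> \<in> S \<rightarrow> carrier H" and "finite T" and "i \<in> T \<rightarrow> S"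
  shows "free_ext H \<phi> (\<Sum>t\<in>T. frag_of (i t)) = finprod H (\<lambda>t. \<phi> (i t)) T"
proof -
  interpret comm_group H by fact
  have hom: "free_ext H \<phi> (a + b) = free_ext H \<phi> a \<otimes>\<^bsub>H\<^esub> free_ext H \<phi> b"
    if "Poly_Mapping.keys a \<subseteq> S" "Poly_Mapping.keys b \<subseteq> S" for a b
    using hom_mult[OF free_ext_hom[OF H \<phi>], of a b] that by simp
  show ?thesis
    using assms(3,4)
  proof (induction T rule: finite_induct)
    case empty
    then show ?case by (simp add: free_ext_def)
  next
    case (insert t T)
    have "Poly_Mapping.keys (\<Sum>t\<in>T. frag_of (i t)) \<subseteq> S"
      using sum_closed_free_Abelian_group[of T "\<lambda>t. frag_of (i t)" S] insert.prems by auto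
    then show ?case
      using insert \<phi> by (simp add: hom free_ext_frag_of[OF H] Pi_iff)
  qed
qed

text \<open>The relators lie in the kernel, hence so does the subgroup they generate, and the image
  of a coset is a single point. This evaluates the maps defined by \<open>the_elem\<close> on
  cosets.\<close>

lemma the_elem_image_rcoset:
  assumes h: "group_hom F H h" and R: "R \<subseteq> carrier F" "\<And>r. r \<in> R \<Longrightarrow> h r = \<one>\<^bsub>H\<^esub>"
    and c: "c \<in> carrier F"
  shows "the_elem (h ` (generate F R #>\<^bsub>F\<^esub> c)) = h c"
proof -
  interpret group_hom F H h by fact
  have sub: "R \<subseteq> kernel F H h" using R by (auto simp: kernel_def)
  have "generate F R \<subseteq> kernel F H h"
    by (rule G.generate_subgroup_incl[OF sub subgroup_kernel])
  then have "h ` (generate F R #>\<^bsub>F\<^esub> c) \<subseteq> {h c}"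
    using c by (auto simp: r_coset_def kernel_def)
  moreover have "h c \<in> h ` (generate F R #>\<^bsub>F\<^esub> c)"
  proof -
    have "\<one>\<^bsub>F\<^esub> \<otimes>\<^bsub>F\<^esub> c \<in> generate F R #>\<^bsub>F\<^esub> c"
      unfolding r_coset_def using generate.one by blast
    then show ?thesis using c by simp
  qed
  ultimately have "h ` (generate F R #>\<^bsub>F\<^esub> c) = {h c}" by auto
  then show ?thesis by simp
qed

section \<open>Groups of module homomorphisms and dual bases\<close>

lemma comm_group_hom_group:
  assumes "right_module A M" and "right_module A N"
  shows "comm_group (hom_group A M N)"
proof -
  interpret M: right_module A M by fact
  interpret N: right_module A N by fact
  have cl: "f x \<in> carrier N" and ad: "f (x \<oplus>\<^bsub>M\<^esub> y) = f x \<oplus>\<^bsub>N\<^esub> f y"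
    and sm: "a \<in> carrier A \<Longrightarrow> f (x \<bullet>\<^bsub>M\<^esub> a) = f x \<bullet>\<^bsub>N\<^esub> a" and ex: "f \<in> extensional (carrier M)"
    if "f \<in> rmod_hom A M N" "x \<in> carrier M" "y \<in> carrier M" for f x y a
    using that by (auto simp: rmod_hom_def PiE_def)
  have ex: "f \<in> extensional (carrier M)" if "f \<in> rmod_hom A M N" for f
    using that by (auto simp: rmod_hom_def PiE_def)
  have neg: "(\<ominus>\<^bsub>N\<^esub> x) \<bullet>\<^bsub>N\<^esub> a = \<ominus>\<^bsub>N\<^esub> (x \<bullet>\<^bsub>N\<^esub> a)" if "x \<in> carrier N" "a \<in> carrier A" for x a
  proof -
    have "(\<ominus>\<^bsub>N\<^esub> x) \<bullet>\<^bsub>N\<^esub> a \<oplus>\<^bsub>N\<^esub> x \<bullet>\<^bsub>N\<^esub> a = \<zero>\<^bsub>N\<^esub>"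
      using that by (simp flip: N.rsmult_l_distr add: N.M.l_neg N.rsmult_zero_left)
    then show ?thesis using that by (metis N.M.a_inv_closed N.M.minus_equality N.rsmult_closed)
  qed
  show ?thesis
  proof (rule comm_groupI)
    fix f g assume f: "f \<in> carrier (hom_group A M N)" and g: "g \<in> carrier (hom_group A M N)"
    then have fg: "f \<in> rmod_hom A M N" "g \<in> rmod_hom A M N" by (auto simp: hom_group_def)
    have "(\<lambda>x\<in>carrier M. f x \<oplus>\<^bsub>N\<^esub> g x) \<in> rmod_hom A M N"
      using cl[OF fg(1)] cl[OF fg(2)] ad[OF fg(1)] ad[OF fg(2)] sm[OF fg(1)] sm[OF fg(2)]
      by (auto simp: rmod_hom_def M.rsmult_closed N.rsmult_l_distr N.M.a_ac)
    then show "f \<otimes>\<^bsub>hom_group A M N\<^esub> g \<in> carrier (hom_group A M N)" by (simp add: hom_group_def)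
    show "f \<otimes>\<^bsub>hom_group A M N\<^esub> g = g \<otimes>\<^bsub>hom_group A M N\<^esub> f"
      using cl[OF fg(1)] cl[OF fg(2)] by (auto simp: hom_group_def N.M.a_comm intro!: restrict_ext)
    fix h assume "h \<in> carrier (hom_group A M N)"
    then have h: "h \<in> rmod_hom A M N" by (simp add: hom_group_def)
    show "f \<otimes>\<^bsub>hom_group A M N\<^esub> g \<otimes>\<^bsub>hom_group A M N\<^esub> h = f \<otimes>\<^bsub>hom_group A M N\<^esub> (g \<otimes>\<^bsub>hom_group A M N\<^esub> h)"
      using cl[OF fg(1)] cl[OF fg(2)] cl[OF h] by (auto simp: hom_group_def N.M.a_assoc intro!: restrict_ext)
  next
    have "(\<lambda>x\<in>carrier M. \<zero>\<^bsub>N\<^esub>) \<in> rmod_hom A M N"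
      by (auto simp: rmod_hom_def M.rsmult_closed N.rsmult_zero_left)
    then show "\<one>\<^bsub>hom_group A M N\<^esub> \<in> carrier (hom_group A M N)" by (simp add: hom_group_def)
  next
    fix f assume "f \<in> carrier (hom_group A M N)"
    then have f: "f \<in> rmod_hom A M N" by (simp add: hom_group_def)
    have "(\<lambda>x\<in>carrier M. f x) = f" using ex[OF f] by (rule extensional_restrict)
    moreover have "(\<lambda>x\<in>carrier M. \<zero>\<^bsub>N\<^esub> \<oplus>\<^bsub>N\<^esub> f x) = (\<lambda>x\<in>carrier M. f x)"
      using cl[OF f] by (auto intro!: restrict_ext)
    ultimately show "\<one>\<^bsub>hom_group A M N\<^esub> \<otimes>\<^bsub>hom_group A M N\<^esub> f = f"
      by (simp add: hom_group_def cong: restrict_cong)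
    have "(\<lambda>x\<in>carrier M. \<ominus>\<^bsub>N\<^esub> f x) \<in> rmod_hom A M N"
      using cl[OF f] ad[OF f] sm[OF f]
      by (auto simp: rmod_hom_def M.rsmult_closed neg N.M.minus_add)
    moreover have "(\<lambda>x\<in>carrier M. \<ominus>\<^bsub>N\<^esub> f x) \<otimes>\<^bsub>hom_group A M N\<^esub> f = \<one>\<^bsub>hom_group A M N\<^esub>"
      using cl[OF f] by (auto simp: hom_group_def N.M.l_neg intro!: restrict_ext)
    ultimately show "\<exists>k\<in>carrier (hom_group A M N). k \<otimes>\<^bsub>hom_group A M N\<^esub> f = \<one>\<^bsub>hom_group A M N\<^esub>"
      by (intro bexI[of _ "\<lambda>x\<in>carrier M. \<ominus>\<^bsub>N\<^esub> f x"]) (auto simp: hom_group_def)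
  qed
qed

lemma hom_group_apply_hom:
  "x \<in> carrier M \<Longrightarrow> (\<lambda>f. f x) \<in> hom (hom_group A M N) (add_monoid N)"
  by (auto simp: hom_def hom_group_def rmod_hom_def)

text \<open>Projectivity splits the surjection from the free module on a finite generating set; the
  coordinates of the splitting are the functionals.\<close>

lemma fin_gen_projective_dual_basis:
  assumes fg: "fin_gen_rmodule A P" and pr: "projective_rmodule A P"
  obtains S F where "finite S" "S \<subseteq> carrier P" "\<And>p. p \<in> S \<Longrightarrow> F p \<in> dual A P"
    "\<And>x. x \<in> carrier P \<Longrightarrow> (\<Oplus>\<^bsub>P\<^esub>p\<in>S. p \<bullet>\<^bsub>P\<^esub> F p x) = x"
proof -
  have rP: "right_module A P" using fg by (simp add: fin_gen_rmodule_def)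
  interpret P: right_module A P by fact
  obtain S where S: "finite S" "S \<subseteq> carrier P"
    "\<And>x. x \<in> carrier P \<Longrightarrow> \<exists>c\<in>S \<rightarrow> carrier A. x = (\<Oplus>\<^bsub>P\<^esub>s\<in>S. s \<bullet>\<^bsub>P\<^esub> c s)"
    using fg by (auto simp: fin_gen_rmodule_def)
  let ?F = "free_rmodule A S" and ?\<pi> = "free_rmodule_map A S P (\<lambda>x. x)"
  have F: "right_module A ?F" by (rule right_module_free_rmodule) (rule P.R.ring_axioms)
  have S': "(\<lambda>x. x) \<in> S \<rightarrow> carrier P" using S(2) by auto
  have \<pi>: "?\<pi> \<in> rmod_hom A ?F P" by (rule P.free_rmodule_map_hom[OF S'])
  have supp: "{x. \<phi> x \<noteq> \<zero>\<^bsub>A\<^esub>} \<subseteq> S" "\<phi> x \<in> carrier A" if "\<phi> \<in> carrier ?F" for \<phi> x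
    using that by (auto simp: free_rmodule_def)
  have \<pi>_eq: "?\<pi> \<phi> = (\<Oplus>\<^bsub>P\<^esub>p\<in>S. p \<bullet>\<^bsub>P\<^esub> \<phi> p)" if "\<phi> \<in> carrier ?F" for \<phi>
    by (rule P.free_rmodule_map_superset[OF S' that S(1) supp(1)[OF that]]) simp
  have surj: "?\<pi> ` carrier ?F = carrier P"
  proof
    show "?\<pi> ` carrier ?F \<subseteq> carrier P" using \<pi> by (auto simp: rmod_hom_def)
    show "carrier P \<subseteq> ?\<pi> ` carrier ?F"
    proof
      fix x assume "x \<in> carrier P"
      then obtain c where c: "c \<in> S \<rightarrow> carrier A" "x = (\<Oplus>\<^bsub>P\<^esub>s\<in>S. s \<bullet>\<^bsub>P\<^esub> c s)" using S(3) by blast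
      let ?\<phi> = "\<lambda>s. if s \<in> S then c s else \<zero>\<^bsub>A\<^esub>"
      have "{x. ?\<phi> x \<noteq> \<zero>\<^bsub>A\<^esub>} \<subseteq> S" by auto
      then have \<phi>: "?\<phi> \<in> carrier ?F"
        using c(1) finite_subset[OF _ S(1)] by (auto simp: free_rmodule_def)
      have eq: "?\<pi> ?\<phi> = x"
        unfolding \<pi>_eq[OF \<phi>] c(2)
        by (rule P.M.add.finprod_cong') (use c S(2) in \<open>auto intro!: P.rsmult_closed\<close>)
      show "x \<in> ?\<pi> ` carrier ?F" by (subst eq[symmetric]) (rule imageI[OF \<phi>])
    qed
  qed
  have id: "(\<lambda>x\<in>carrier P. x) \<in> rmod_hom A P P"
    using P.rsmult_closed by (auto simp: rmod_hom_def)
  have "\<exists>h\<in>rmod_hom A P ?F. \<forall>x\<in>carrier P. ?\<pi> (h x) = (\<lambda>x\<in>carrier P. x) x"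
    by (rule projective_rmodule_lift[OF pr F rP \<pi> surj id])
  then obtain \<sigma> where \<sigma>: "\<sigma> \<in> rmod_hom A P ?F"
      "\<forall>x\<in>carrier P. ?\<pi> (\<sigma> x) = (\<lambda>x\<in>carrier P. x) x"
    by (rule bexE)
  have \<sigma>F: "\<sigma> x \<in> carrier ?F" if "x \<in> carrier P" for x using \<sigma>(1) that by (auto simp: rmod_hom_def)
  show thesis
  proof (rule that[OF S(1,2), of "\<lambda>p. \<lambda>x\<in>carrier P. \<sigma> x p"])
    fix p
    have "\<sigma> (x \<oplus>\<^bsub>P\<^esub> y) = \<sigma> x \<oplus>\<^bsub>?F\<^esub> \<sigma> y" if "x \<in> carrier P" "y \<in> carrier P" for x y
      using \<sigma>(1) that by (auto simp: rmod_hom_def)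
    moreover have "\<sigma> (x \<bullet>\<^bsub>P\<^esub> a) = \<sigma> x \<bullet>\<^bsub>?F\<^esub> a" if "x \<in> carrier P" "a \<in> carrier A" for x a
      using \<sigma>(1) that by (auto simp: rmod_hom_def)
    moreover have "(\<phi> \<oplus>\<^bsub>?F\<^esub> \<psi>) p = \<phi> p \<oplus>\<^bsub>A\<^esub> \<psi> p" "(\<phi> \<bullet>\<^bsub>?F\<^esub> a) p = \<phi> p \<otimes>\<^bsub>A\<^esub> a" for \<phi> \<psi> a
      by (simp_all add: free_rmodule_def)
    ultimately show "(\<lambda>x\<in>carrier P. \<sigma> x p) \<in> dual A P"
      using supp(2)[OF \<sigma>F] unfolding rmod_hom_def regular_rmodule_def
      by (simp add: P.rsmult_closed)
  next
    fix x assume x: "x \<in> carrier P"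
    then have "?\<pi> (\<sigma> x) = x" using \<sigma>(2) by simp
    then show "(\<Oplus>\<^bsub>P\<^esub>p\<in>S. p \<bullet>\<^bsub>P\<^esub> (\<lambda>x\<in>carrier P. \<sigma> x p) x) = x"
      unfolding \<pi>_eq[OF \<sigma>F[OF x]] by (simp add: x)
  qed
qed

section \<open>The tensor product with the dual\<close>

lemma right_module_regular_rmodule:
  assumes "ring A" shows "right_module A (regular_rmodule A)"
proof -
  interpret ring A by fact
  have "abelian_group (regular_rmodule A)"
    by (rule abelian_groupI) (auto simp: regular_rmodule_def a_ac l_neg intro!: bexI[of _ "\<ominus>\<^bsub>A\<^esub> _"])
  then show ?thesis
    by (intro right_module.intro right_module_axioms.intro ring_axioms)
      (simp_all add: regular_rmodule_def l_distr r_distr m_assoc)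
qed

lemma dual_closed: "f \<in> dual A P \<Longrightarrow> x \<in> carrier P \<Longrightarrow> f x \<in> carrier A"
  and dual_add: "f \<in> dual A P \<Longrightarrow> x \<in> carrier P \<Longrightarrow> y \<in> carrier P \<Longrightarrow> f (x \<oplus>\<^bsub>P\<^esub> y) = f x \<oplus>\<^bsub>A\<^esub> f y"
  and dual_rsmult: "f \<in> dual A P \<Longrightarrow> x \<in> carrier P \<Longrightarrow> a \<in> carrier A \<Longrightarrow> f (x \<bullet>\<^bsub>P\<^esub> a) = f x \<otimes>\<^bsub>A\<^esub> a"
  by (auto simp: rmod_hom_def regular_rmodule_def)

lemma dual_lsmult_closed:
  assumes "right_module A P" and "f \<in> dual A P" and "a \<in> carrier A"
  shows "dual_lsmult A P a f \<in> dual A P"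
proof -
  interpret right_module A P by fact
  show ?thesis
    using dual_closed[OF assms(2)] dual_add[OF assms(2)] dual_rsmult[OF assms(2)] assms(3)
    by (auto simp: dual_lsmult_def rmod_hom_def regular_rmodule_def rsmult_closed R.r_distr R.m_assoc)
qed

text \<open>The universal property of the tensor product in terms of cosets: \<open>add_l\<close>,
  \<open>add_r\<close> and \<open>bal\<close> send the defining relations to the unit of
  \<open>H\<close>.\<close>

lemma tensor_dual_coset_lift:
  assumes P: "right_module A P" and H: "comm_group H"
    and \<psi>: "\<psi> \<in> carrier P \<times> dual A P \<rightarrow> carrier H"
    and add_l: "\<And>p q f. p \<in> carrier P \<Longrightarrow> q \<in> carrier P \<Longrightarrow> f \<in> dual A P \<Longrightarrow>
      \<psi> (p \<oplus>\<^bsub>P\<^esub> q, f) = \<psi> (p, f) \<otimes>\<^bsub>H\<^esub> \<psi> (q, f)"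
    and add_r: "\<And>p f g. p \<in> carrier P \<Longrightarrow> f \<in> dual A P \<Longrightarrow> g \<in> dual A P \<Longrightarrow>
      \<psi> (p, f \<otimes>\<^bsub>hom_group A P (regular_rmodule A)\<^esub> g) = \<psi> (p, f) \<otimes>\<^bsub>H\<^esub> \<psi> (p, g)"
    and bal: "\<And>p a f. p \<in> carrier P \<Longrightarrow> a \<in> carrier A \<Longrightarrow> f \<in> dual A P \<Longrightarrow>
      \<psi> (p \<bullet>\<^bsub>P\<^esub> a, f) = \<psi> (p, dual_lsmult A P a f)"
    and c: "Poly_Mapping.keys c \<subseteq> carrier P \<times> dual A P"
  shows "the_elem (free_ext H \<psi> ` (generate (free_Abelian_group (carrier P \<times> dual A P)) (tensor_dual_relations A P)
      #>\<^bsub>free_Abelian_group (carrier P \<times> dual A P)\<^esub> c)) = free_ext H \<psi> c"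
proof (rule the_elem_image_rcoset)
  interpret P: right_module A P by fact
  interpret H: comm_group H by fact
  interpret D: comm_group "hom_group A P (regular_rmodule A)"
    by (rule comm_group_hom_group[OF P right_module_regular_rmodule]) (rule P.R.ring_axioms)
  let ?S = "carrier P \<times> dual A P"
  let ?F = "free_Abelian_group ?S" and ?h = "free_ext H \<psi>"
  show gh: "group_hom ?F H ?h"
    by (intro group_hom.intro group_hom_axioms.intro free_ext_hom[OF H \<psi>] group_free_Abelian_group) (rule H.is_group)
  interpret group_hom ?F H ?h by (rule gh)
  show "c \<in> carrier ?F" using c by simp
  have D: "f \<otimes>\<^bsub>hom_group A P (regular_rmodule A)\<^esub> g \<in> dual A P" if "f \<in> dual A P" "g \<in> dual A P" for f g
    using D.m_closed[of f g] that by (simp add: hom_group_def)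
  have kd: "Poly_Mapping.keys (a - b) \<subseteq> ?S" if "Poly_Mapping.keys a \<subseteq> ?S" "Poly_Mapping.keys b \<subseteq> ?S"
    for a b :: "('c \<times> ('c \<Rightarrow> 'a)) \<Rightarrow>\<^sub>0 int"
    using keys_diff[of a b] that by blast
  have fo: "Poly_Mapping.keys (frag_of u) \<subseteq> ?S" "?h (frag_of u) = \<psi> u" "\<psi> u \<in> carrier H" if "u \<in> ?S" for u
    using that \<psi> by (simp, intro free_ext_frag_of[OF H], blast+)
  have diff: "?h (a - b) = ?h a \<otimes>\<^bsub>H\<^esub> inv\<^bsub>H\<^esub> ?h b"
    if "Poly_Mapping.keys a \<subseteq> ?S" "Poly_Mapping.keys b \<subseteq> ?S" for a b
    using hom_mult[of a "- b"] hom_inv[of b] that by simp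
  \<comment> \<open>The relations have two shapes: \<open>d3\<close> serves both kinds of
    additivity, \<open>d2\<close> the balancing.\<close>
  have d3: "frag_of u - frag_of v - frag_of w \<in> carrier ?F \<and> ?h (frag_of u - frag_of v - frag_of w) = \<one>\<^bsub>H\<^esub>"
    if "u \<in> ?S" "v \<in> ?S" "w \<in> ?S" "\<psi> u = \<psi> v \<otimes>\<^bsub>H\<^esub> \<psi> w" for u v w
  proof -
    have "\<psi> v \<otimes>\<^bsub>H\<^esub> \<psi> w \<otimes>\<^bsub>H\<^esub> inv\<^bsub>H\<^esub> \<psi> v \<otimes>\<^bsub>H\<^esub> inv\<^bsub>H\<^esub> \<psi> w
        = (\<psi> v \<otimes>\<^bsub>H\<^esub> \<psi> w) \<otimes>\<^bsub>H\<^esub> inv\<^bsub>H\<^esub> (\<psi> v \<otimes>\<^bsub>H\<^esub> \<psi> w)"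
      using fo[OF that(2)] fo[OF that(3)] by (simp add: H.m_assoc H.inv_mult)
    also have "\<dots> = \<one>\<^bsub>H\<^esub>" using fo[OF that(2)] fo[OF that(3)] by (intro H.r_inv) simp
    finally show ?thesis
      using fo[OF that(1)] fo[OF that(2)] fo[OF that(3)] that(4) by (simp add: diff kd del: keys_single)
  qed
  have d2: "frag_of u - frag_of v \<in> carrier ?F \<and> ?h (frag_of u - frag_of v) = \<one>\<^bsub>H\<^esub>"
    if "u \<in> ?S" "v \<in> ?S" "\<psi> u = \<psi> v" for u v
    using fo[OF that(1)] fo[OF that(2)] that(3) by (simp add: diff kd del: keys_single)
  have all: "r \<in> carrier ?F \<and> ?h r = \<one>\<^bsub>H\<^esub>" if r: "r \<in> tensor_dual_relations A P" for r
  proof -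
    consider (add_l) p q f where "r = frag_of (p \<oplus>\<^bsub>P\<^esub> q, f) - frag_of (p, f) - frag_of (q, f)"
        "p \<in> carrier P" "q \<in> carrier P" "f \<in> dual A P"
      | (add_r) p f g where "r = frag_of (p, f \<otimes>\<^bsub>hom_group A P (regular_rmodule A)\<^esub> g) - frag_of (p, f) - frag_of (p, g)"
        "p \<in> carrier P" "f \<in> dual A P" "g \<in> dual A P"
      | (bal) p a f where "r = frag_of (p \<bullet>\<^bsub>P\<^esub> a, f) - frag_of (p, dual_lsmult A P a f)"
        "p \<in> carrier P" "a \<in> carrier A" "f \<in> dual A P"
      using r unfolding tensor_dual_relations_def by blast
    then show ?thesis
    proof cases
      case l: add_l
      show ?thesis unfolding l(1) using l(2-) by (intro d3 add_l) auto
    next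
      case l: add_r
      show ?thesis unfolding l(1) using l(2-) by (intro d3 add_r) (auto intro: D)
    next
      case l: bal
      show ?thesis unfolding l(1) using l(2-)
        by (intro d2 bal) (auto intro: P.rsmult_closed dual_lsmult_closed[OF P])
    qed
  qed
  show "tensor_dual_relations A P \<subseteq> carrier ?F" using all by blast
  show "?h r = \<one>\<^bsub>H\<^esub>" if "r \<in> tensor_dual_relations A P" for r using all[OF that] by blast
qed

section \<open>The quotient by commutators and the rank as a coset\<close>

lemma commutator_subgroup_subgroup:
  assumes "ring A" shows "subgroup (commutator_subgroup A) (add_monoid A)"
proof -
  interpret ring A by fact
  show ?thesis
    unfolding commutator_subgroup_def
    by (rule add.generate_is_subgroup) auto
qed

lemma comm_group_commutator_quotient: "ring A \<Longrightarrow> comm_group (commutator_quotient A)"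
  unfolding commutator_quotient_def
  by (intro comm_group.abelian_FactGroup commutator_subgroup_subgroup abelian_group.a_comm_group ring.is_abelian_group)

lemma commutator_quotient_hom:
  assumes "ring A"
  shows "(\<lambda>a. commutator_subgroup A #>\<^bsub>add_monoid A\<^esub> a) \<in> hom (add_monoid A) (commutator_quotient A)"
  unfolding commutator_quotient_def
  by (intro normal.r_coset_hom_Mod comm_group.subgroup_imp_normal commutator_subgroup_subgroup
      abelian_group.a_comm_group ring.is_abelian_group assms)

text \<open>The two products differ by a generator of the subgroup. This makes evaluation balanced,
  where \<open>f p \<otimes> a\<close> has to agree with \<open>a \<otimes> f p\<close>.\<close>

lemma commutator_coset_commute:
  assumes "ring A" "a \<in> carrier A" "b \<in> carrier A"
  shows "commutator_subgroup A #>\<^bsub>add_monoid A\<^esub> (a \<otimes>\<^bsub>A\<^esub> b) = commutator_subgroup A #>\<^bsub>add_monoid A\<^esub> (b \<otimes>\<^bsub>A\<^esub> a)"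
proof -
  interpret ring A by fact
  have "a \<otimes>\<^bsub>A\<^esub> b \<ominus>\<^bsub>A\<^esub> b \<otimes>\<^bsub>A\<^esub> a \<in> commutator_subgroup A"
    unfolding commutator_subgroup_def using assms by (intro generate.incl) blast
  moreover have "a \<otimes>\<^bsub>A\<^esub> b = (a \<otimes>\<^bsub>A\<^esub> b \<ominus>\<^bsub>A\<^esub> b \<otimes>\<^bsub>A\<^esub> a) \<oplus>\<^bsub>A\<^esub> b \<otimes>\<^bsub>A\<^esub> a"
    using assms by (simp add: a_minus_def a_assoc l_neg)
  ultimately have "a \<otimes>\<^bsub>A\<^esub> b \<in> commutator_subgroup A #>\<^bsub>add_monoid A\<^esub> (b \<otimes>\<^bsub>A\<^esub> a)"
    unfolding r_coset_def by auto
  then show ?thesis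
    using add.repr_independence[of "a \<otimes>\<^bsub>A\<^esub> b" "commutator_subgroup A" "b \<otimes>\<^bsub>A\<^esub> a"]
      commutator_subgroup_subgroup[OF assms(1)] assms by simp
qed

text \<open>Any preimage of the identity in the tensor product is as good as a dual basis, so the
  injectivity of \<open>tensor_dual_to_End\<close> is not needed to compute the rank.\<close>

lemma hattori_stallings_rank_eq:
  assumes fg: "fin_gen_rmodule A P" and pr: "projective_rmodule A P"
  obtains c where "Poly_Mapping.keys c \<subseteq> carrier P \<times> dual A P"
    "\<And>x. x \<in> carrier P \<Longrightarrow> free_ext (add_monoid P) (\<lambda>(p, f). p \<bullet>\<^bsub>P\<^esub> f x) c = x"
    "hattori_stallings_rank A P = commutator_subgroup A #>\<^bsub>add_monoid A\<^esub> free_ext (add_monoid A) (\<lambda>(p, f). f p) c"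
proof -
  have P: "right_module A P" using fg by (simp add: fin_gen_rmodule_def)
  interpret P: right_module A P by fact
  note rA = P.R.ring_axioms
  let ?S = "carrier P \<times> dual A P"
  let ?F = "free_Abelian_group ?S"
  let ?K = "generate ?F (tensor_dual_relations A P)"
  let ?E = "hom_group A P P" and ?\<psi> = "\<lambda>(p, f). \<lambda>x\<in>carrier P. p \<bullet>\<^bsub>P\<^esub> f x"
  let ?Q = "commutator_quotient A" and ?\<chi> = "\<lambda>(p, f). commutator_subgroup A #>\<^bsub>add_monoid A\<^esub> f p"
  have E: "comm_group ?E" by (rule comm_group_hom_group[OF P P])
  have Q: "comm_group ?Q" by (rule comm_group_commutator_quotient[OF rA])
  have aP: "comm_group (add_monoid P)" by (rule P.M.a_comm_group)
  have aA: "comm_group (add_monoid A)" by (rule P.R.a_comm_group)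
  note q = commutator_quotient_hom[OF rA]
  note du = dual_closed dual_add dual_rsmult
  have \<psi>: "?\<psi> \<in> ?S \<rightarrow> carrier ?E"
  proof
    fix u assume "u \<in> ?S"
    then obtain p f where u: "u = (p, f)" "p \<in> carrier P" "f \<in> dual A P" by auto
    then show "?\<psi> u \<in> carrier ?E"
      unfolding u(1) prod.case
      by (simp add: hom_group_def rmod_hom_def[of A P P] P.rsmult_closed du P.rsmult_r_distr P.rsmult_assoc)
  qed
  have \<chi>: "?\<chi> \<in> ?S \<rightarrow> carrier ?Q"
    using q by (auto simp: hom_def du)
  have to_End: "tensor_dual_to_End A P (?K #>\<^bsub>?F\<^esub> c) = free_ext ?E ?\<psi> c" if "Poly_Mapping.keys c \<subseteq> ?S" for c
    unfolding tensor_dual_to_End_def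
    by (rule tensor_dual_coset_lift[OF P E \<psi> _ _ _ that]; unfold prod.case)
      (simp_all add: hom_group_def regular_rmodule_def[of A] dual_lsmult_def du P.rsmult_closed P.rsmult_l_distr
        P.rsmult_r_distr P.rsmult_assoc cong: restrict_cong)
  have eval: "tensor_dual_eval A P (?K #>\<^bsub>?F\<^esub> c) = free_ext ?Q ?\<chi> c" if "Poly_Mapping.keys c \<subseteq> ?S" for c
    unfolding tensor_dual_eval_def
  proof (rule tensor_dual_coset_lift[OF P Q \<chi> _ _ _ that])
    fix p a f assume "p \<in> carrier P" "a \<in> carrier A" "f \<in> dual A P"
    then show "?\<chi> (p \<bullet>\<^bsub>P\<^esub> a, f) = ?\<chi> (p, dual_lsmult A P a f)"
      by (simp add: dual_lsmult_def du commutator_coset_commute[OF rA])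
  qed (use hom_mult[OF q] in \<open>auto simp: hom_group_def regular_rmodule_def du\<close>)
  \<comment> \<open>Evaluation at \<open>x\<close> is a homomorphism from the endomorphisms to
    \<open>P\<close>, so it passes inside the extension.\<close>
  have at: "(free_ext ?E ?\<psi> c) x = free_ext (add_monoid P) (\<lambda>(p, f). p \<bullet>\<^bsub>P\<^esub> f x) c"
    if "Poly_Mapping.keys c \<subseteq> ?S" "x \<in> carrier P" for c x
    using free_ext_hom_eq[OF E aP \<psi> hom_group_apply_hom[OF that(2)] that(1)] that(2)
    by (simp add: case_prod_unfold)
  have T: "carrier (tensor_dual A P) = (\<lambda>c. ?K #>\<^bsub>?F\<^esub> c) ` carrier ?F"
    by (simp add: tensor_dual_def carrier_FactGroup)
  obtain S b where S: "finite S" "S \<subseteq> carrier P" "\<And>p. p \<in> S \<Longrightarrow> b p \<in> dual A P"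
    "\<And>x. x \<in> carrier P \<Longrightarrow> (\<Oplus>\<^bsub>P\<^esub>p\<in>S. p \<bullet>\<^bsub>P\<^esub> b p x) = x"
    using fin_gen_projective_dual_basis[OF fg pr] by blast
  \<comment> \<open>A dual basis gives one tensor over the identity. It ensures that
    \<open>inv_into\<close> picks a genuine preimage, which need not be this one.\<close>
  let ?c0 = "\<Sum>p\<in>S. frag_of (p, b p)"
  have c0: "Poly_Mapping.keys ?c0 \<subseteq> ?S"
    using sum_closed_free_Abelian_group[of S "\<lambda>p. frag_of (p, b p)" ?S] S by auto
  have fE: "free_ext ?E ?\<psi> c \<in> extensional (carrier P)" if "Poly_Mapping.keys c \<subseteq> ?S" for c
    using hom_in_carrier[OF free_ext_hom[OF E \<psi>], of c] that
    by (auto simp: hom_group_def rmod_hom_def PiE_def)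
  have c0_id: "tensor_dual_to_End A P (?K #>\<^bsub>?F\<^esub> ?c0) = (\<lambda>x\<in>carrier P. x)"
    unfolding to_End[OF c0]
  proof (rule extensionalityI[OF fE[OF c0]])
    fix x assume x: "x \<in> carrier P"
    have "free_ext ?E ?\<psi> ?c0 x = finprod (add_monoid P) (\<lambda>p. case (p, b p) of (p, f) \<Rightarrow> p \<bullet>\<^bsub>P\<^esub> f x) S"
      unfolding at[OF c0 x]
      by (rule free_ext_sum_frag_of[OF aP _ S(1), where S = ?S])
        (use S x in \<open>auto simp: P.rsmult_closed du\<close>)
    then show "free_ext ?E ?\<psi> ?c0 x = (\<lambda>x\<in>carrier P. x) x"
      using S(4)[OF x] x by (simp add: finsum_def)
  qed simp
  have "?K #>\<^bsub>?F\<^esub> ?c0 \<in> carrier (tensor_dual A P)" using c0 unfolding T by auto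
  then have id: "(\<lambda>x\<in>carrier P. x) \<in> tensor_dual_to_End A P ` carrier (tensor_dual A P)"
    unfolding c0_id[symmetric] by (rule imageI)
  let ?t = "inv_into (carrier (tensor_dual A P)) (tensor_dual_to_End A P) (\<lambda>x\<in>carrier P. x)"
  have "?t \<in> carrier (tensor_dual A P)" by (rule inv_into_into[OF id])
  then obtain c where c: "Poly_Mapping.keys c \<subseteq> ?S" "?t = ?K #>\<^bsub>?F\<^esub> c" unfolding T by auto
  have "free_ext ?E ?\<psi> c = (\<lambda>x\<in>carrier P. x)"
    using f_inv_into_f[OF id] unfolding c(2) to_End[OF c(1)] .
  then have 1: "free_ext (add_monoid P) (\<lambda>(p, f). p \<bullet>\<^bsub>P\<^esub> f x) c = x" if "x \<in> carrier P" for x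
    using at[OF c(1) that] that by simp
  have ev: "(\<lambda>(p, f). f p) \<in> ?S \<rightarrow> carrier (add_monoid A)" by (auto simp: du)
  have "hattori_stallings_rank A P = free_ext ?Q ?\<chi> c"
    unfolding hattori_stallings_rank_def hattori_stallings_trace_def c(2) eval[OF c(1)] ..
  also have "\<dots> = commutator_subgroup A #>\<^bsub>add_monoid A\<^esub> free_ext (add_monoid A) (\<lambda>(p, f). f p) c"
    using free_ext_hom_eq[OF aA Q ev q c(1)] by (simp add: case_prod_unfold)
  finally have rank: "hattori_stallings_rank A P =
    commutator_subgroup A #>\<^bsub>add_monoid A\<^esub> free_ext (add_monoid A) (\<lambda>(p, f). f p) c" .
  show thesis by (rule that[OF c(1) _ rank]) (rule 1)
qed

section \<open>Integral group rings\<close>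

text \<open>The additive functional with values \<phi> on the basis. Elements of the group ring are
  handled through such functionals instead of explicit convolutions.\<close>

definition frag_sum :: "('a \<Rightarrow> int) \<Rightarrow> ('a \<Rightarrow>\<^sub>0 int) \<Rightarrow> int" where
  "frag_sum \<phi> a = (\<Sum>x\<in>Poly_Mapping.keys a. Poly_Mapping.lookup a x * \<phi> x)"

lemma frag_sum_superset:
  assumes "finite B" "Poly_Mapping.keys a \<subseteq> B"
  shows "frag_sum \<phi> a = (\<Sum>x\<in>B. Poly_Mapping.lookup a x * \<phi> x)"
  unfolding frag_sum_def
  by (rule sum.mono_neutral_left) (use assms in \<open>auto simp: in_keys_iff\<close>)

lemma frag_sum_0 [simp]: "frag_sum \<phi> 0 = 0"
  by (simp add: frag_sum_def)

lemma frag_sum_frag_of [simp]: "frag_sum \<phi> (frag_of x) = \<phi> x"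
  by (simp add: frag_sum_def)

lemma frag_sum_add: "frag_sum \<phi> (a + b) = frag_sum \<phi> a + frag_sum \<phi> b"
proof -
  let ?B = "Poly_Mapping.keys a \<union> Poly_Mapping.keys b"
  show ?thesis
    using frag_sum_superset[of ?B a \<phi>] frag_sum_superset[of ?B b \<phi>]
      frag_sum_superset[OF _ keys_add[of a b], of \<phi>]
    by (simp add: lookup_add distrib_right sum.distrib)
qed

lemma frag_sum_cmul: "frag_sum \<phi> (frag_cmul k a) = k * frag_sum \<phi> a"
  using frag_sum_superset[OF finite_keys keys_cmul, of \<phi> k a]
  by (simp add: frag_sum_def sum_distrib_left mult.assoc)

lemma frag_sum_frag_extend:
  "frag_sum \<phi> (frag_extend \<psi> c) = frag_sum (\<lambda>x. frag_sum \<phi> (\<psi> x)) c"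
proof -
  have "frag_sum \<phi> (sum f B) = (\<Sum>x\<in>B. frag_sum \<phi> (f x))" if "finite B" for f :: "'b \<Rightarrow> 'a \<Rightarrow>\<^sub>0 int" and B
    using that by (induction B rule: finite_induct) (auto simp: frag_sum_add)
  then show ?thesis by (simp add: frag_extend_def frag_sum_cmul frag_sum_def[of _ c])
qed

lemma lookup_eq_frag_sum: "Poly_Mapping.lookup a x = frag_sum (\<lambda>y. of_bool (y = x)) a"
proof -
  let ?B = "insert x (Poly_Mapping.keys a)"
  have "frag_sum (\<lambda>y. of_bool (y = x)) a = (\<Sum>y\<in>?B. Poly_Mapping.lookup a y * of_bool (y = x))"
    by (rule frag_sum_superset) auto
  also have "\<dots> = Poly_Mapping.lookup a x + (\<Sum>y\<in>?B - {x}. Poly_Mapping.lookup a y * of_bool (y = x))"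
    by (subst sum.remove[of _ x]) auto
  also have "(\<Sum>y\<in>?B - {x}. Poly_Mapping.lookup a y * of_bool (y = x)) = 0"
    by (rule sum.neutral) auto
  finally show ?thesis by simp
qed

lemma add_monoid_int_group_ring: "add_monoid (int_group_ring G) = free_Abelian_group (carrier G)"
  by (simp add: int_group_ring_def free_Abelian_group_def)

lemma carrier_int_group_ring: "a \<in> carrier (int_group_ring G) \<longleftrightarrow> Poly_Mapping.keys a \<subseteq> carrier G"
  by (simp add: int_group_ring_def)

lemma frag_sum_int_group_ring_mult:
  "frag_sum \<phi> (a \<otimes>\<^bsub>int_group_ring G\<^esub> b) = frag_sum (\<lambda>x. frag_sum (\<lambda>y. \<phi> (x \<otimes>\<^bsub>G\<^esub> y)) b) a"
  by (simp add: int_group_ring_def frag_sum_frag_extend)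

lemma free_ext_free_Abelian_group:
  assumes \<psi>: "\<psi> \<in> S \<rightarrow> carrier (free_Abelian_group T)" and c: "Poly_Mapping.keys c \<subseteq> S"
  shows "free_ext (free_Abelian_group T) \<psi> c = frag_extend \<psi> c"
proof -
  have keys: "Poly_Mapping.keys (\<psi> x) \<subseteq> T" if "x \<in> S" for x
    using Pi_mem[OF \<psi> that] by simp
  have hom: "frag_extend \<psi> \<in> hom (free_Abelian_group S) (free_Abelian_group T)"
    using keys keys_frag_extend[of \<psi>] by (fastforce simp: hom_def frag_extend_add)
  show ?thesis
    by (rule hom_free_Abelian_group_eqI[OF _ free_ext_hom[OF abelian_free_Abelian_group \<psi>] hom _ c])
      (use keys in \<open>auto simp: free_ext_frag_of[OF abelian_free_Abelian_group]\<close>)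
qed

context group
begin

lemma frag_sum_mult_commute:
  assumes "a \<in> carrier (int_group_ring G)" "b \<in> carrier (int_group_ring G)"
    and \<phi>: "\<And>x y. x \<in> carrier G \<Longrightarrow> y \<in> carrier G \<Longrightarrow> \<phi> (x \<otimes> y) = \<phi> (y \<otimes> x)"
  shows "frag_sum \<phi> (a \<otimes>\<^bsub>int_group_ring G\<^esub> b) = frag_sum \<phi> (b \<otimes>\<^bsub>int_group_ring G\<^esub> a)"
proof -
  have "frag_sum \<phi> (a \<otimes>\<^bsub>int_group_ring G\<^esub> b) = (\<Sum>x\<in>Poly_Mapping.keys a. \<Sum>y\<in>Poly_Mapping.keys b.
      Poly_Mapping.lookup a x * (Poly_Mapping.lookup b y * \<phi> (x \<otimes> y)))"
    by (simp add: frag_sum_int_group_ring_mult) (simp add: frag_sum_def sum_distrib_left)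
  also have "\<dots> = (\<Sum>y\<in>Poly_Mapping.keys b. \<Sum>x\<in>Poly_Mapping.keys a.
      Poly_Mapping.lookup b y * (Poly_Mapping.lookup a x * \<phi> (y \<otimes> x)))"
    using assms(1,2) by (subst sum.swap) (intro sum.cong refl, auto simp: carrier_int_group_ring intro!: \<phi>)
  also have "\<dots> = frag_sum \<phi> (b \<otimes>\<^bsub>int_group_ring G\<^esub> a)"
    by (simp add: frag_sum_int_group_ring_mult) (simp add: frag_sum_def sum_distrib_left)
  finally show ?thesis .
qed

text \<open>The map to classes kills commutators because \<open>x y\<close> and \<open>y x\<close>
  are conjugate, so it is constant on the coset.\<close>

lemma to_conj_classes_coset:
  assumes ring: "ring (int_group_ring G)" and a: "a \<in> carrier (int_group_ring G)"
  shows "to_conj_classes G (commutator_subgroup (int_group_ring G) #>\<^bsub>add_monoid (int_group_ring G)\<^esub> a)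
    = frag_extend (\<lambda>x. frag_of (conj_class G x)) a"
proof -
  interpret Z: ring "int_group_ring G" by fact
  let ?Z = "int_group_ring G" and ?h = "frag_extend (\<lambda>x. frag_of (conj_class G x))"
  let ?F = "free_Abelian_group (carrier G)" and ?H = "free_Abelian_group (UNIV :: 'a set set)"
  have gh: "group_hom ?F ?H ?h"
    by (intro group_hom.intro group_hom_axioms.intro) (auto simp: hom_def frag_extend_add)
  have diff: "x \<ominus>\<^bsub>?Z\<^esub> y = x - y" if "x \<in> carrier ?Z" "y \<in> carrier ?Z" for x y
  proof -
    have "\<ominus>\<^bsub>?Z\<^esub> y = - y"
      by (rule Z.minus_equality) (use that(2) in \<open>simp_all add: int_group_ring_def\<close>)
    then show ?thesis by (simp add: a_minus_def) (simp add: int_group_ring_def)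
  qed
  \<comment> \<open>Compared coefficientwise: the indicator of a class \<open>C\<close>, composed
    with \<open>conj_class G\<close>, is unchanged when two factors are exchanged.\<close>
  have comm: "?h (x \<otimes>\<^bsub>?Z\<^esub> y) = ?h (y \<otimes>\<^bsub>?Z\<^esub> x)" if "x \<in> carrier ?Z" "y \<in> carrier ?Z" for x y
  proof (rule poly_mapping_eqI)
    fix C
    show "Poly_Mapping.lookup (?h (x \<otimes>\<^bsub>?Z\<^esub> y)) C = Poly_Mapping.lookup (?h (y \<otimes>\<^bsub>?Z\<^esub> x)) C"
      unfolding lookup_eq_frag_sum frag_sum_frag_extend
      by (rule frag_sum_mult_commute[OF that]) (simp add: conj_class_mult_commute)
  qed
  show ?thesis
    unfolding to_conj_classes_def commutator_subgroup_def add_monoid_int_group_ring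
  proof (rule the_elem_image_rcoset[OF gh])
    let ?R = "{x \<otimes>\<^bsub>?Z\<^esub> y \<ominus>\<^bsub>?Z\<^esub> y \<otimes>\<^bsub>?Z\<^esub> x |x y. x \<in> carrier ?Z \<and> y \<in> carrier ?Z}"
    have "?R \<subseteq> carrier ?Z" by auto
    then show "?R \<subseteq> carrier ?F" by (simp add: int_group_ring_def)
    show "?h r = \<one>\<^bsub>?H\<^esub>" if "r \<in> ?R" for r
      using that by (auto simp: diff frag_extend_diff comm)
    show "a \<in> carrier ?F" using a by (simp add: int_group_ring_def)
  qed
qed

end

section \<open>From a preimage of the identity to the conjugacy of powers of
  \<open>g\<close>\<close>

theorem theorem1:
  fixes G :: "('g, 'x) monoid_scheme" and g :: 'g
    and P :: "('g \<Rightarrow>\<^sub>0 int, 'p) rmodule"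
  assumes "group G" and "g \<in> carrier G"
    and "fin_gen_rmodule (int_group_ring G) P"
    and "projective_rmodule (int_group_ring G) P"
    and "hs_coeff G P g \<noteq> 0"
  shows "\<exists>m::nat. m > 0 \<and> (\<forall>s::nat. s > 0 \<longrightarrow> g [^]\<^bsub>G\<^esub> (s ^ m) \<in> conj_class G g)"
proof -
  interpret group G by fact
  let ?Z = "int_group_ring G"
  have P: "right_module ?Z P" using assms(3) by (simp add: fin_gen_rmodule_def)
  interpret P: right_module ?Z P by fact
  let ?S = "carrier P \<times> dual ?Z P"
  obtain c where c: "Poly_Mapping.keys c \<subseteq> ?S"
    and id: "\<And>x. x \<in> carrier P \<Longrightarrow> free_ext (add_monoid P) (\<lambda>(p, f). p \<bullet>\<^bsub>P\<^esub> f x) c = x"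
    and rank: "hattori_stallings_rank ?Z P =
      commutator_subgroup ?Z #>\<^bsub>add_monoid ?Z\<^esub> free_ext (add_monoid ?Z) (\<lambda>(p, f). f p) c"
    using hattori_stallings_rank_eq[OF assms(3,4)] by blast
  let ?I = "Poly_Mapping.keys c" and ?n = "Poly_Mapping.lookup c"
  \<comment> \<open>The indices are the pairs occurring in the preimage \<open>c\<close>; the entry
    at \<open>(q, h)\<close> and \<open>(p, f)\<close> is \<open>h p\<close>.\<close>
  define e where "e u v = snd u (fst v)" for u v :: "'p \<times> ('p \<Rightarrow> 'g \<Rightarrow>\<^sub>0 int)"
  have e: "e u v \<in> carrier ?Z" if "u \<in> ?S" "v \<in> ?S" for u v
    using that by (auto simp: e_def dual_closed)
  \<comment> \<open>All group elements occurring in the entries; finiteness of \<open>B\<close>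
    keeps the set of letters finite.\<close>
  define B where "B = (\<Union>u\<in>?I. \<Union>v\<in>?I. Poly_Mapping.keys (e u v))"
  have B: "finite B" "B \<subseteq> carrier G"
    using c e by (auto simp: B_def carrier_int_group_ring subset_iff) blast
  have eB: "frag_sum \<phi> (e u v) = (\<Sum>x\<in>B. Poly_Mapping.lookup (e u v) x * \<phi> x)" if "u \<in> ?I" "v \<in> ?I" for \<phi> u v
    by (rule frag_sum_superset[OF B(1)]) (use that in \<open>auto simp: B_def\<close>)
  have ext: "free_ext (add_monoid ?Z) \<psi> c = frag_extend \<psi> c" if "\<psi> \<in> ?S \<rightarrow> carrier ?Z" for \<psi>
    unfolding add_monoid_int_group_ring
    by (rule free_ext_free_Abelian_group[OF _ c]) (use that in \<open>simp add: int_group_ring_def\<close>)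
  have idem: "e u v = frag_extend (\<lambda>t. e u t \<otimes>\<^bsub>?Z\<^esub> e t v) c" if uv: "u \<in> ?S" "v \<in> ?S" for u v
  proof -
    obtain q h p f where u: "u = (q, h)" "h \<in> dual ?Z P" and v: "v = (p, f)" "p \<in> carrier P"
      using uv by auto
    have h: "h \<in> hom (add_monoid P) (add_monoid ?Z)"
      using u(2) by (auto simp: hom_def dual_closed dual_add)
    have \<psi>: "(\<lambda>(q, f). q \<bullet>\<^bsub>P\<^esub> f p) \<in> ?S \<rightarrow> carrier (add_monoid P)"
      using v(2) by (auto simp: P.rsmult_closed dual_closed)
    \<comment> \<open>Applying \<open>h\<close> to the expansion of \<open>p\<close> given by
      \<open>id\<close> shows that \<open>e u v\<close> is the sum over \<open>t\<close> of
      \<open>?n t\<close> times the product of \<open>e u t\<close> and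
      \<open>e t v\<close>.\<close>
    have "h p = h (free_ext (add_monoid P) (\<lambda>(q, f). q \<bullet>\<^bsub>P\<^esub> f p) c)" using id[OF v(2)] by simp
    also have "\<dots> = free_ext (add_monoid ?Z) (\<lambda>t. h (case t of (q, f) \<Rightarrow> q \<bullet>\<^bsub>P\<^esub> f p)) c"
      by (rule free_ext_hom_eq[OF P.M.a_comm_group P.R.a_comm_group \<psi> h c])
    also have "\<dots> = frag_extend (\<lambda>t. h (case t of (q, f) \<Rightarrow> q \<bullet>\<^bsub>P\<^esub> f p)) c"
      by (rule ext) (use u(2) v(2) in \<open>auto simp: P.rsmult_closed dual_closed\<close>)
    also have "\<dots> = frag_extend (\<lambda>t. e u t \<otimes>\<^bsub>?Z\<^esub> e t v) c"
      by (rule frag_extend_eq) (use c u v in \<open>auto simp: e_def dual_rsmult dual_closed\<close>)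
    finally show ?thesis by (simp add: e_def u v)
  qed
  \<comment> \<open>The factor \<open>?n v\<close> absorbs the multiplicities in the identity for
    \<open>e\<close>, so that \<open>a\<close> describes a genuine idempotent matrix.\<close>
  define a where "a u v x = ?n v * Poly_Mapping.lookup (e u v) x" for u v x
  have a_idem: "(\<Sum>t\<in>?I. \<Sum>y\<in>B. \<Sum>z\<in>B. a u t y * a t v z * \<phi> (y \<otimes>\<^bsub>G\<^esub> z)) = (\<Sum>x\<in>B. a u v x * \<phi> x)"
    if uv: "u \<in> ?I" "v \<in> ?I" for u v and \<phi> :: "'g \<Rightarrow> int"
  proof -
    have uv': "u \<in> ?S" "v \<in> ?S" using uv c by blast+
    have "(\<Sum>x\<in>B. a u v x * \<phi> x) = ?n v * frag_sum \<phi> (e u v)"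
      using uv by (simp add: a_def eB sum_distrib_left mult.assoc)
    also have "frag_sum \<phi> (e u v) = (\<Sum>t\<in>?I. ?n t * frag_sum (\<lambda>y. frag_sum (\<lambda>z. \<phi> (y \<otimes>\<^bsub>G\<^esub> z)) (e t v)) (e u t))"
      by (subst idem[OF uv']) (simp add: frag_sum_frag_extend frag_sum_int_group_ring_mult frag_sum_def[of _ c])
    also have "\<dots> = (\<Sum>t\<in>?I. ?n t * (\<Sum>y\<in>B. Poly_Mapping.lookup (e u t) y *
        (\<Sum>z\<in>B. Poly_Mapping.lookup (e t v) z * \<phi> (y \<otimes>\<^bsub>G\<^esub> z))))"
      using uv by (simp add: eB)
    finally show ?thesis
      by (simp add: a_def sum_distrib_left mult_ac)
  qed
  have ev: "(\<lambda>(p, f). f p) \<in> ?S \<rightarrow> carrier ?Z" by (auto simp: dual_closed)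
  \<comment> \<open>The rank is the class of the sum of \<open>?n u\<close> times
    \<open>e u u\<close>, which is the trace of the matrix given by \<open>a\<close>.\<close>
  have coeff: "hs_coeff G P x = (\<Sum>u\<in>?I. \<Sum>y\<in>B. a u u y * of_bool (conj_class G y = conj_class G x))" for x
  proof -
    have "free_ext (add_monoid ?Z) (\<lambda>(p, f). f p) c \<in> carrier (add_monoid ?Z)"
      by (rule hom_in_carrier[OF free_ext_hom[OF P.R.a_comm_group]]) (use ev c in simp_all)
    then have "frag_extend (\<lambda>(p, f). f p) c \<in> carrier ?Z"
      unfolding ext[OF ev] by simp
    then have "hs_coeff G P x = frag_sum (\<lambda>y. of_bool (conj_class G y = conj_class G x)) (frag_extend (\<lambda>(p, f). f p) c)"
      unfolding hs_coeff_def rank ext[OF ev]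
      by (subst to_conj_classes_coset) (simp_all add: P.R.ring_axioms lookup_eq_frag_sum frag_sum_frag_extend)
    also have "frag_extend (\<lambda>(p, f). f p) c = frag_extend (\<lambda>u. e u u) c"
      by (simp add: e_def case_prod_unfold)
    finally show ?thesis
      by (simp add: frag_sum_frag_extend frag_sum_def[of _ c] eB a_def sum_distrib_left mult.assoc)
  qed
  let ?c = "\<lambda>x. \<Sum>u\<in>?I. a u u x"
  have swap: "(\<Sum>u\<in>?I. \<Sum>x\<in>B. a u u x * \<phi> x) = (\<Sum>x\<in>B. ?c x * \<phi> x)" for \<phi> :: "'g \<Rightarrow> int"
    by (subst sum.swap) (simp add: sum_distrib_right)
  show ?thesis
  proof (rule conj_class_power_periodic[OF B assms(2)])
    \<comment> \<open>The invariance of the trace under powers is tested on the indicator of the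
      class \<open>C\<close>.\<close>
    show "(\<Sum>x\<in>B. ?c x * of_bool (conj_class G x = C)) = (\<Sum>x\<in>B. ?c x * of_bool (conj_class G (x [^]\<^bsub>G\<^esub> s) = C))"
      if "s > 0" for C and s :: nat
      unfolding swap[symmetric]
      by (rule idempotent_trace_power[OF finite_keys B a_idem, where \<phi> = "\<lambda>x. of_bool (conj_class G x = C)"])
        (simp_all add: conj_class_mult_commute that)
    show "(\<Sum>x\<in>B. ?c x * of_bool (conj_class G x = conj_class G g)) \<noteq> 0"
      using assms(5) unfolding coeff swap .
  qed
qed

end
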